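(* Let $(\mathcal{C},\otimes,I)$ be a symmetric monoidal category and consider the oplax monoidal functor $\mathrm{List}^+\colon\mathcal{C}^{\mathbb{N}}\to\mathcal{C}^{\mathbb{N}}$. Then $\mathrm{List}^+$ (with this oplax monoidal structure) admits the structure of an oplax monoidal comonad if and only if $\mathcal{C}$ is cartesian monoidal.
   Context: $\mathcal{C}^{\mathbb{N}}$ is the monoidal category of sequences $\mathbf{X}=(X_0,X_1,\dots)$ of objects of $\mathcal{C}$, with componentwise morphisms and tensor, unit the constant sequence $(I,I,\dots)$. $\mathrm{List}^+$ is defined by $\mathrm{List}^+(\mathbf{X})_n=\bigotimes_{i=0}^n X_i$ and $\mathrm{List}^+(\mathbf{f})_n=f_0\otimes\dots\otimes f_n$; it is oplax monoidal with structure maps $\psi_0\colon\mathrm{List}^+(\mathbf{I})\to\mathbf{I}$ and $\psi_{\mathbf{X},\mathbf{Y}}\colon\mathrm{List}^+(\mathbf{X}\otimes\mathbf{Y})\to\mathrm{List}^+(\mathbf{X})\otimes\mathrm{List}^+(\mathbf{Y})$ given componentwise by symmetries, associators and unitors. An oplax monoidal comonad on a monoidal category is a comonad $(R,\varepsilon,\delta)$ whose underlying endofunctor $R$ is oplax monoidal (with given structure maps) and whose counit $\varepsilon\colon R\Rightarrow\mathrm{Id}$ and comultiplication $\delta\colon R\Rightarrow RR$ are monoidal natural transformations (with respect to the identity oplax structure on $\mathrm{Id}$ and the composite oplax structure on $RR$). Cartesian monoidal: the tensor is the categorical product and the unit is terminal. *)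

theory Defs
  imports Main
begin

section \<open>Categories\<close>

record ('o, 'a) cat =
  Obj :: "'o set"
  Arr :: "'a set"
  Dom :: "'a \<Rightarrow> 'o"
  Cod :: "'a \<Rightarrow> 'o"
  Idn :: "'o \<Rightarrow> 'a"
  Cmp :: "'a \<Rightarrow> 'a \<Rightarrow> 'a"  (infixr \<open>\<cdot>\<index>\<close> 60)

text \<open>Composition is written in applicative order: \<open>g \<cdot> f\<close> is \<open>f\<close> followed by \<open>g\<close>.\<close>

definition hom :: "('o, 'a, 'x) cat_scheme \<Rightarrow> 'o \<Rightarrow> 'o \<Rightarrow> 'a set" where
  "hom C X Y = {f \<in> Arr C. Dom C f = X \<and> Cod C f = Y}"

locale category =
  fixes C :: "('o, 'a, 'x) cat_scheme" (structure)
  assumes Dom_in_Obj: "f \<in> Arr C \<Longrightarrow> Dom C f \<in> Obj C"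
    and Cod_in_Obj: "f \<in> Arr C \<Longrightarrow> Cod C f \<in> Obj C"
    and Idn_in_hom: "X \<in> Obj C \<Longrightarrow> Idn C X \<in> hom C X X"
    and Cmp_in_hom: "\<lbrakk>f \<in> hom C X Y; g \<in> hom C Y Z\<rbrakk> \<Longrightarrow> g \<cdot> f \<in> hom C X Z"
    and Cmp_Idn_left: "f \<in> hom C X Y \<Longrightarrow> Idn C Y \<cdot> f = f"
    and Cmp_Idn_right: "f \<in> hom C X Y \<Longrightarrow> f \<cdot> Idn C X = f"
    and Cmp_assoc: "\<lbrakk>f \<in> hom C W X; g \<in> hom C X Y; h \<in> hom C Y Z\<rbrakk>
      \<Longrightarrow> (h \<cdot> g) \<cdot> f = h \<cdot> (g \<cdot> f)"

definition inverse_arrows :: "('o, 'a, 'x) cat_scheme \<Rightarrow> 'a \<Rightarrow> 'a \<Rightarrow> bool" where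
  "inverse_arrows C f g \<longleftrightarrow>
     f \<in> Arr C \<and> g \<in> hom C (Cod C f) (Dom C f) \<and>
     g \<cdot>\<^bsub>C\<^esub> f = Idn C (Dom C f) \<and> f \<cdot>\<^bsub>C\<^esub> g = Idn C (Cod C f)"

definition iso_arr :: "('o, 'a, 'x) cat_scheme \<Rightarrow> 'a \<Rightarrow> bool" where
  "iso_arr C f \<longleftrightarrow> (\<exists>g. inverse_arrows C f g)"

definition inv_arr :: "('o, 'a, 'x) cat_scheme \<Rightarrow> 'a \<Rightarrow> 'a" where
  "inv_arr C f = (THE g. inverse_arrows C f g)"

definition terminal :: "('o, 'a, 'x) cat_scheme \<Rightarrow> 'o \<Rightarrow> bool" where
  "terminal C T \<longleftrightarrow> T \<in> Obj C \<and> (\<forall>X\<in>Obj C. \<exists>!f. f \<in> hom C X T)"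

definition to_terminal :: "('o, 'a, 'x) cat_scheme \<Rightarrow> 'o \<Rightarrow> 'o \<Rightarrow> 'a" where
  "to_terminal C T X = (THE f. f \<in> hom C X T)"

definition is_product ::
    "('o, 'a, 'x) cat_scheme \<Rightarrow> 'o \<Rightarrow> 'o \<Rightarrow> 'o \<Rightarrow> 'a \<Rightarrow> 'a \<Rightarrow> bool" where
  "is_product C X Y P p q \<longleftrightarrow>
     X \<in> Obj C \<and> Y \<in> Obj C \<and> P \<in> Obj C \<and> p \<in> hom C P X \<and> q \<in> hom C P Y \<and>
     (\<forall>Z\<in>Obj C. \<forall>f\<in>hom C Z X. \<forall>g\<in>hom C Z Y.
        \<exists>!h. h \<in> hom C Z P \<and> p \<cdot>\<^bsub>C\<^esub> h = f \<and> q \<cdot>\<^bsub>C\<^esub> h = g)"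


section \<open>Monoidal categories\<close>

text \<open>The tensor product is written \<open>\<otimes>\<close> on objects and \<open>\<odot>\<close> on arrows.\<close>

record ('o, 'a) moncat = "('o, 'a) cat" +
  TensObj :: "'o \<Rightarrow> 'o \<Rightarrow> 'o"  (infixr \<open>\<otimes>\<index>\<close> 75)
  TensArr :: "'a \<Rightarrow> 'a \<Rightarrow> 'a"  (infixr \<open>\<odot>\<index>\<close> 75)
  Unit :: "'o"
  Assoc :: "'o \<Rightarrow> 'o \<Rightarrow> 'o \<Rightarrow> 'a"
  LUnit :: "'o \<Rightarrow> 'a"
  RUnit :: "'o \<Rightarrow> 'a"

locale monoidal_category = category C
  for C :: "('o, 'a, 'x) moncat_scheme" (structure) +
  assumes Unit_in_Obj: "Unit C \<in> Obj C"
    and TensObj_in_Obj: "\<lbrakk>X \<in> Obj C; Y \<in> Obj C\<rbrakk> \<Longrightarrow> X \<otimes> Y \<in> Obj C"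
    and TensArr_in_hom: "\<lbrakk>f \<in> hom C X X'; g \<in> hom C Y Y'\<rbrakk>
      \<Longrightarrow> f \<odot> g \<in> hom C (X \<otimes> Y) (X' \<otimes> Y')"
    and TensArr_Idn: "\<lbrakk>X \<in> Obj C; Y \<in> Obj C\<rbrakk> \<Longrightarrow> Idn C X \<odot> Idn C Y = Idn C (X \<otimes> Y)"
    and TensArr_Cmp: "\<lbrakk>f \<in> hom C X X'; f' \<in> hom C X' X''; g \<in> hom C Y Y'; g' \<in> hom C Y' Y''\<rbrakk>
      \<Longrightarrow> (f' \<cdot> f) \<odot> (g' \<cdot> g) = (f' \<odot> g') \<cdot> (f \<odot> g)"
    and Assoc_in_hom: "\<lbrakk>X \<in> Obj C; Y \<in> Obj C; Z \<in> Obj C\<rbrakk>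
      \<Longrightarrow> Assoc C X Y Z \<in> hom C ((X \<otimes> Y) \<otimes> Z) (X \<otimes> (Y \<otimes> Z))"
    and Assoc_iso: "\<lbrakk>X \<in> Obj C; Y \<in> Obj C; Z \<in> Obj C\<rbrakk> \<Longrightarrow> iso_arr C (Assoc C X Y Z)"
    and Assoc_natural: "\<lbrakk>f \<in> hom C X X'; g \<in> hom C Y Y'; h \<in> hom C Z Z'\<rbrakk>
      \<Longrightarrow> Assoc C X' Y' Z' \<cdot> ((f \<odot> g) \<odot> h) = (f \<odot> (g \<odot> h)) \<cdot> Assoc C X Y Z"
    and LUnit_in_hom: "X \<in> Obj C \<Longrightarrow> LUnit C X \<in> hom C (Unit C \<otimes> X) X"
    and LUnit_iso: "X \<in> Obj C \<Longrightarrow> iso_arr C (LUnit C X)"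
    and LUnit_natural: "f \<in> hom C X Y
      \<Longrightarrow> LUnit C Y \<cdot> (Idn C (Unit C) \<odot> f) = f \<cdot> LUnit C X"
    and RUnit_in_hom: "X \<in> Obj C \<Longrightarrow> RUnit C X \<in> hom C (X \<otimes> Unit C) X"
    and RUnit_iso: "X \<in> Obj C \<Longrightarrow> iso_arr C (RUnit C X)"
    and RUnit_natural: "f \<in> hom C X Y
      \<Longrightarrow> RUnit C Y \<cdot> (f \<odot> Idn C (Unit C)) = f \<cdot> RUnit C X"
    and pentagon: "\<lbrakk>W \<in> Obj C; X \<in> Obj C; Y \<in> Obj C; Z \<in> Obj C\<rbrakk>
      \<Longrightarrow> (Idn C W \<odot> Assoc C X Y Z) \<cdot> Assoc C W (X \<otimes> Y) Z \<cdot> (Assoc C W X Y \<odot> Idn C Z)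
        = Assoc C W X (Y \<otimes> Z) \<cdot> Assoc C (W \<otimes> X) Y Z"
    and triangle: "\<lbrakk>X \<in> Obj C; Y \<in> Obj C\<rbrakk>
      \<Longrightarrow> (Idn C X \<odot> LUnit C Y) \<cdot> Assoc C X (Unit C) Y = RUnit C X \<odot> Idn C Y"

record ('o, 'a) symmoncat = "('o, 'a) moncat" +
  Symm :: "'o \<Rightarrow> 'o \<Rightarrow> 'a"

locale symmetric_monoidal_category = monoidal_category C
  for C :: "('o, 'a, 'x) symmoncat_scheme" (structure) +
  assumes Symm_in_hom: "\<lbrakk>X \<in> Obj C; Y \<in> Obj C\<rbrakk> \<Longrightarrow> Symm C X Y \<in> hom C (X \<otimes> Y) (Y \<otimes> X)"
    and Symm_natural: "\<lbrakk>f \<in> hom C X X'; g \<in> hom C Y Y'\<rbrakk>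
      \<Longrightarrow> Symm C X' Y' \<cdot> (f \<odot> g) = (g \<odot> f) \<cdot> Symm C X Y"
    and Symm_Symm: "\<lbrakk>X \<in> Obj C; Y \<in> Obj C\<rbrakk> \<Longrightarrow> Symm C Y X \<cdot> Symm C X Y = Idn C (X \<otimes> Y)"
    and Symm_unit: "X \<in> Obj C \<Longrightarrow> LUnit C X \<cdot> Symm C X (Unit C) = RUnit C X"
    and hexagon: "\<lbrakk>X \<in> Obj C; Y \<in> Obj C; Z \<in> Obj C\<rbrakk>
      \<Longrightarrow> Assoc C Y Z X \<cdot> Symm C X (Y \<otimes> Z) \<cdot> Assoc C X Y Z
        = (Idn C Y \<odot> Symm C X Z) \<cdot> Assoc C Y X Z \<cdot> (Symm C X Y \<odot> Idn C Z)"

text \<open>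
  The projections of the tensor product are the ones induced by discarding a factor,
  \<open>X \<otimes> Y \<rightarrow> X \<otimes> I \<cong> X\<close> and \<open>X \<otimes> Y \<rightarrow> I \<otimes> Y \<cong> Y\<close>.  If \<open>f \<odot> g\<close> and the unitors are the
  morphisms induced by some choice of product projections, then these projections are
  necessarily the chosen ones.
\<close>

definition cartesian_monoidal :: "('o, 'a, 'x) moncat_scheme \<Rightarrow> bool" where
  "cartesian_monoidal C \<longleftrightarrow>
     terminal C (Unit C) \<and>
     (\<forall>X\<in>Obj C. \<forall>Y\<in>Obj C. is_product C X Y (X \<otimes>\<^bsub>C\<^esub> Y)
        (RUnit C X \<cdot>\<^bsub>C\<^esub> (Idn C X \<odot>\<^bsub>C\<^esub> to_terminal C (Unit C) Y))
        (LUnit C Y \<cdot>\<^bsub>C\<^esub> (to_terminal C (Unit C) X \<odot>\<^bsub>C\<^esub> Idn C Y)))"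


section \<open>Oplax monoidal functors and comonads\<close>

text \<open>
  \<open>OpUnit F\<close> is the structure map \<open>F I \<rightarrow> I\<close> and \<open>OpTens F X Y\<close> is the structure map
  \<open>F (X \<otimes> Y) \<rightarrow> F X \<otimes> F Y\<close>.
\<close>

record ('o, 'a, 'p, 'b) oplax =
  FObj :: "'o \<Rightarrow> 'p"
  FArr :: "'a \<Rightarrow> 'b"
  OpUnit :: "'b"
  OpTens :: "'o \<Rightarrow> 'o \<Rightarrow> 'b"

locale oplax_monoidal_functor = C: monoidal_category C + D: monoidal_category D
  for C :: "('o, 'a, 'x) moncat_scheme"
    and D :: "('p, 'b, 'y) moncat_scheme" (structure)
    and F :: "('o, 'a, 'p, 'b) oplax" +
  assumes FObj_in_Obj: "X \<in> Obj C \<Longrightarrow> FObj F X \<in> Obj D"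
    and FArr_in_hom: "f \<in> hom C X Y \<Longrightarrow> FArr F f \<in> hom D (FObj F X) (FObj F Y)"
    and FArr_Idn: "X \<in> Obj C \<Longrightarrow> FArr F (Idn C X) = Idn D (FObj F X)"
    and FArr_Cmp: "\<lbrakk>f \<in> hom C X Y; g \<in> hom C Y Z\<rbrakk>
      \<Longrightarrow> FArr F (g \<cdot>\<^bsub>C\<^esub> f) = FArr F g \<cdot> FArr F f"
    and OpUnit_in_hom: "OpUnit F \<in> hom D (FObj F (Unit C)) (Unit D)"
    and OpTens_in_hom: "\<lbrakk>X \<in> Obj C; Y \<in> Obj C\<rbrakk>
      \<Longrightarrow> OpTens F X Y \<in> hom D (FObj F (X \<otimes>\<^bsub>C\<^esub> Y)) (FObj F X \<otimes> FObj F Y)"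
    and OpTens_natural: "\<lbrakk>f \<in> hom C X X'; g \<in> hom C Y Y'\<rbrakk>
      \<Longrightarrow> OpTens F X' Y' \<cdot> FArr F (f \<odot>\<^bsub>C\<^esub> g) = (FArr F f \<odot> FArr F g) \<cdot> OpTens F X Y"
    and oplax_assoc: "\<lbrakk>X \<in> Obj C; Y \<in> Obj C; Z \<in> Obj C\<rbrakk>
      \<Longrightarrow> Assoc D (FObj F X) (FObj F Y) (FObj F Z)
            \<cdot> (OpTens F X Y \<odot> Idn D (FObj F Z)) \<cdot> OpTens F (X \<otimes>\<^bsub>C\<^esub> Y) Z
        = (Idn D (FObj F X) \<odot> OpTens F Y Z) \<cdot> OpTens F X (Y \<otimes>\<^bsub>C\<^esub> Z) \<cdot> FArr F (Assoc C X Y Z)"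
    and oplax_lunit: "X \<in> Obj C
      \<Longrightarrow> LUnit D (FObj F X) \<cdot> (OpUnit F \<odot> Idn D (FObj F X)) \<cdot> OpTens F (Unit C) X
        = FArr F (LUnit C X)"
    and oplax_runit: "X \<in> Obj C
      \<Longrightarrow> RUnit D (FObj F X) \<cdot> (Idn D (FObj F X) \<odot> OpUnit F) \<cdot> OpTens F X (Unit C)
        = FArr F (RUnit C X)"

definition id_oplax :: "('o, 'a, 'x) moncat_scheme \<Rightarrow> ('o, 'a, 'o, 'a) oplax" where
  "id_oplax C = \<lparr>
     FObj = (\<lambda>X. X),
     FArr = (\<lambda>f. f),
     OpUnit = Idn C (Unit C),
     OpTens = (\<lambda>X Y. Idn C (X \<otimes>\<^bsub>C\<^esub> Y))\<rparr>"

text \<open>The composite \<open>G \<circ> F\<close>, where \<open>E\<close> is the codomain of \<open>G\<close>.\<close>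

definition comp_oplax ::
    "('q, 'c, 'z) moncat_scheme \<Rightarrow> ('p, 'b, 'q, 'c) oplax \<Rightarrow> ('o, 'a, 'p, 'b) oplax
      \<Rightarrow> ('o, 'a, 'q, 'c) oplax" where
  "comp_oplax E G F = \<lparr>
     FObj = (\<lambda>X. FObj G (FObj F X)),
     FArr = (\<lambda>f. FArr G (FArr F f)),
     OpUnit = OpUnit G \<cdot>\<^bsub>E\<^esub> FArr G (OpUnit F),
     OpTens = (\<lambda>X Y. OpTens G (FObj F X) (FObj F Y) \<cdot>\<^bsub>E\<^esub> FArr G (OpTens F X Y))\<rparr>"

locale monoidal_nat_trans =
  F: oplax_monoidal_functor C D F + G: oplax_monoidal_functor C D G
  for C :: "('o, 'a, 'x) moncat_scheme"
    and D :: "('p, 'b, 'y) moncat_scheme" (structure)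
    and F :: "('o, 'a, 'p, 'b) oplax"
    and G :: "('o, 'a, 'p, 'b) oplax"
    and \<theta> :: "'o \<Rightarrow> 'b" +
  assumes component_in_hom: "X \<in> Obj C \<Longrightarrow> \<theta> X \<in> hom D (FObj F X) (FObj G X)"
    and natural: "f \<in> hom C X Y \<Longrightarrow> \<theta> Y \<cdot> FArr F f = FArr G f \<cdot> \<theta> X"
    and monoidal_unit: "OpUnit G \<cdot> \<theta> (Unit C) = OpUnit F"
    and monoidal_tensor: "\<lbrakk>X \<in> Obj C; Y \<in> Obj C\<rbrakk>
      \<Longrightarrow> OpTens G X Y \<cdot> \<theta> (X \<otimes>\<^bsub>C\<^esub> Y) = (\<theta> X \<odot> \<theta> Y) \<cdot> OpTens F X Y"

locale oplax_monoidal_comonad =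
  R: oplax_monoidal_functor C C R +
  counit: monoidal_nat_trans C C R "id_oplax C" \<epsilon> +
  comult: monoidal_nat_trans C C R "comp_oplax C R R" \<delta>
  for C :: "('o, 'a, 'x) moncat_scheme" (structure)
    and R :: "('o, 'a, 'o, 'a) oplax"
    and \<epsilon> :: "'o \<Rightarrow> 'a"
    and \<delta> :: "'o \<Rightarrow> 'a" +
  assumes comonad_counit_left: "X \<in> Obj C \<Longrightarrow> \<epsilon> (FObj R X) \<cdot> \<delta> X = Idn C (FObj R X)"
    and comonad_counit_right: "X \<in> Obj C \<Longrightarrow> FArr R (\<epsilon> X) \<cdot> \<delta> X = Idn C (FObj R X)"
    and comonad_coassoc: "X \<in> Obj C \<Longrightarrow> \<delta> (FObj R X) \<cdot> \<delta> X = FArr R (\<delta> X) \<cdot> \<delta> X"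


section \<open>Sequences and nonempty lists\<close>

definition seq_cat :: "('o, 'a, 'x) moncat_scheme \<Rightarrow> (nat \<Rightarrow> 'o, nat \<Rightarrow> 'a) moncat" where
  "seq_cat C = \<lparr>
     Obj = {X. \<forall>n. X n \<in> Obj C},
     Arr = {f. \<forall>n. f n \<in> Arr C},
     Dom = (\<lambda>f n. Dom C (f n)),
     Cod = (\<lambda>f n. Cod C (f n)),
     Idn = (\<lambda>X n. Idn C (X n)),
     Cmp = (\<lambda>g f n. g n \<cdot>\<^bsub>C\<^esub> f n),
     TensObj = (\<lambda>X Y n. X n \<otimes>\<^bsub>C\<^esub> Y n),
     TensArr = (\<lambda>f g n. f n \<odot>\<^bsub>C\<^esub> g n),
     Unit = (\<lambda>n. Unit C),
     Assoc = (\<lambda>X Y Z n. Assoc C (X n) (Y n) (Z n)),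
     LUnit = (\<lambda>X n. LUnit C (X n)),
     RUnit = (\<lambda>X n. RUnit C (X n))\<rparr>"

text \<open>Iterated tensors are bracketed to the left: \<open>((X\<^sub>0 \<otimes> X\<^sub>1) \<otimes> \<dots>) \<otimes> X\<^sub>n\<close>.\<close>

primrec list_obj :: "('o, 'a, 'x) moncat_scheme \<Rightarrow> (nat \<Rightarrow> 'o) \<Rightarrow> nat \<Rightarrow> 'o" where
  "list_obj C X 0 = X 0"
| "list_obj C X (Suc n) = list_obj C X n \<otimes>\<^bsub>C\<^esub> X (Suc n)"

primrec list_arr :: "('o, 'a, 'x) moncat_scheme \<Rightarrow> (nat \<Rightarrow> 'a) \<Rightarrow> nat \<Rightarrow> 'a" where
  "list_arr C f 0 = f 0"
| "list_arr C f (Suc n) = list_arr C f n \<odot>\<^bsub>C\<^esub> f (Suc n)"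

text \<open>The canonical map \<open>(A \<otimes> B) \<otimes> (A' \<otimes> B') \<rightarrow> (A \<otimes> A') \<otimes> (B \<otimes> B')\<close>.\<close>

definition interchange :: "('o, 'a, 'x) symmoncat_scheme \<Rightarrow> 'o \<Rightarrow> 'o \<Rightarrow> 'o \<Rightarrow> 'o \<Rightarrow> 'a" where
  "interchange C A B A' B' =
     inv_arr C (Assoc C A A' (B \<otimes>\<^bsub>C\<^esub> B'))
     \<cdot>\<^bsub>C\<^esub> (Idn C A \<odot>\<^bsub>C\<^esub> Assoc C A' B B')
     \<cdot>\<^bsub>C\<^esub> (Idn C A \<odot>\<^bsub>C\<^esub> (Symm C B A' \<odot>\<^bsub>C\<^esub> Idn C B'))
     \<cdot>\<^bsub>C\<^esub> (Idn C A \<odot>\<^bsub>C\<^esub> inv_arr C (Assoc C B A' B'))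
     \<cdot>\<^bsub>C\<^esub> Assoc C A B (A' \<otimes>\<^bsub>C\<^esub> B')"

primrec list_op_unit :: "('o, 'a, 'x) moncat_scheme \<Rightarrow> nat \<Rightarrow> 'a" where
  "list_op_unit C 0 = Idn C (Unit C)"
| "list_op_unit C (Suc n) =
     RUnit C (Unit C) \<cdot>\<^bsub>C\<^esub> (list_op_unit C n \<odot>\<^bsub>C\<^esub> Idn C (Unit C))"

primrec list_op_tens ::
    "('o, 'a, 'x) symmoncat_scheme \<Rightarrow> (nat \<Rightarrow> 'o) \<Rightarrow> (nat \<Rightarrow> 'o) \<Rightarrow> nat \<Rightarrow> 'a" where
  "list_op_tens C X Y 0 = Idn C (X 0 \<otimes>\<^bsub>C\<^esub> Y 0)"
| "list_op_tens C X Y (Suc n) =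
     interchange C (list_obj C X n) (list_obj C Y n) (X (Suc n)) (Y (Suc n))
     \<cdot>\<^bsub>C\<^esub> (list_op_tens C X Y n \<odot>\<^bsub>C\<^esub> Idn C (X (Suc n) \<otimes>\<^bsub>C\<^esub> Y (Suc n)))"

definition ListPlus ::
    "('o, 'a, 'x) symmoncat_scheme
      \<Rightarrow> (nat \<Rightarrow> 'o, nat \<Rightarrow> 'a, nat \<Rightarrow> 'o, nat \<Rightarrow> 'a) oplax" where
  "ListPlus C = \<lparr>
     FObj = list_obj C,
     FArr = list_arr C,
     OpUnit = list_op_unit C,
     OpTens = list_op_tens C\<rparr>"

end

theory Submission
  imports Defs
begin

text \<open>
  Write \<open>I\<close> for the unit.  Given a comonad, \<open>\<epsilon>\<close> at \<open>(X, I, I, \<dots>)\<close> in degree 1 is a natural map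
  \<open>X \<cong> X \<otimes> I \<rightarrow> I\<close> which is the identity for \<open>X = I\<close>, so \<open>I\<close> is terminal and the tensor has
  projections.  In degree 1, \<open>\<delta>\<close> at \<open>(X, I, I, \<dots>)\<close> is a natural map \<open>X \<rightarrow> X \<otimes> X\<close>; by the counit laws
  its two components are split monomorphisms with retractions coming from \<open>\<epsilon>\<close>, which gives the
  existence of pairings, and monoidality of \<open>\<delta>\<close> gives their uniqueness.

  Conversely, between cartesian monoidal categories a functor whose structure maps are compatible
  with the projections is automatically oplax monoidal, and every natural transformation between
  such functors is monoidal.  So only the comonad laws remain for \<open>\<epsilon>\<close> the last projection and
  \<open>\<delta>\<close> the tuple of all prefixes.
\<close>

section \<open>Categories and monoidal categories\<close>

context category
begin

lemma Dom_Obj [simp]: "f \<in> Arr C \<Longrightarrow> Dom C f \<in> Obj C"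
  and Cod_Obj [simp]: "f \<in> Arr C \<Longrightarrow> Cod C f \<in> Obj C"
  by (rule Dom_in_Obj Cod_in_Obj; simp)+

lemma Arr_Idn [simp]: "X \<in> Obj C \<Longrightarrow> Idn C X \<in> Arr C"
  and Dom_Idn [simp]: "X \<in> Obj C \<Longrightarrow> Dom C (Idn C X) = X"
  and Cod_Idn [simp]: "X \<in> Obj C \<Longrightarrow> Cod C (Idn C X) = X"
  using Idn_in_hom[of X] by (simp_all add: hom_def)

lemma
  assumes "f \<in> Arr C" "g \<in> Arr C" "Dom C g = Cod C f"
  shows Arr_Cmp [simp]: "g \<cdot> f \<in> Arr C"
    and Dom_Cmp [simp]: "Dom C (g \<cdot> f) = Dom C f"
    and Cod_Cmp [simp]: "Cod C (g \<cdot> f) = Cod C g"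
  using Cmp_in_hom[of f "Dom C f" "Cod C f" g "Cod C g"] assms by (simp_all add: hom_def)

lemma Idn_Cmp [simp]: "f \<in> Arr C \<Longrightarrow> Cod C f = Y \<Longrightarrow> Idn C Y \<cdot> f = f"
  and Cmp_Idn [simp]: "f \<in> Arr C \<Longrightarrow> Dom C f = X \<Longrightarrow> f \<cdot> Idn C X = f"
  by (auto intro: Cmp_Idn_left Cmp_Idn_right simp: hom_def)

lemma Cmp_Cmp [simp]:
  "\<lbrakk>f \<in> Arr C; g \<in> Arr C; h \<in> Arr C; Dom C g = Cod C f; Dom C h = Cod C g\<rbrakk>
    \<Longrightarrow> (h \<cdot> g) \<cdot> f = h \<cdot> (g \<cdot> f)"
  by (rule Cmp_assoc) (auto simp: hom_def)

text \<open>Composites are kept nested to the right, where an equation for a two-fold composite no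
  longer matches if a further arrow is composed on the right. This form makes such equations
  applicable again.\<close>

lemma Cmp_reassoc:
  assumes "k \<cdot> g = h" "f \<in> Arr C" "g \<in> Arr C" "k \<in> Arr C" "Dom C g = Cod C f" "Dom C k = Cod C g"
  shows "k \<cdot> (g \<cdot> f) = h \<cdot> f"
  using assms(1) Cmp_Cmp[OF assms(2-6)] by simp

section \<open>Inverses and cancellation of isomorphisms\<close>

lemma inverse_arrows_unique:
  assumes "inverse_arrows C f g" "inverse_arrows C f h"
  shows "g = h"
proof -
  have *: "f \<in> Arr C" "g \<in> Arr C" "Dom C g = Cod C f" "Cod C g = Dom C f" "g \<cdot> f = Idn C (Dom C f)"
    "h \<in> Arr C" "Dom C h = Cod C f" "Cod C h = Dom C f" "f \<cdot> h = Idn C (Cod C f)"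
    using assms by (auto simp: inverse_arrows_def hom_def)
  have "g = g \<cdot> (f \<cdot> h)" using * by simp
  also have "\<dots> = (g \<cdot> f) \<cdot> h" by (rule Cmp_Cmp[symmetric]) (simp_all add: *)
  also have "\<dots> = h" using * by simp
  finally show ?thesis .
qed

lemma
  assumes "iso_arr C f"
  shows Arr_iso: "f \<in> Arr C"
    and Arr_inv [simp]: "inv_arr C f \<in> Arr C"
    and Dom_inv [simp]: "Dom C (inv_arr C f) = Cod C f"
    and Cod_inv [simp]: "Cod C (inv_arr C f) = Dom C f"
    and inv_Cmp [simp]: "inv_arr C f \<cdot> f = Idn C (Dom C f)"
    and Cmp_inv [simp]: "f \<cdot> inv_arr C f = Idn C (Cod C f)"
proof -
  obtain g where g: "inverse_arrows C f g" using assms by (auto simp: iso_arr_def)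
  then have "inv_arr C f = g"
    unfolding inv_arr_def using inverse_arrows_unique by blast
  with g have "inverse_arrows C f (inv_arr C f)" by simp
  then show "f \<in> Arr C" "inv_arr C f \<in> Arr C" "Dom C (inv_arr C f) = Cod C f"
    "Cod C (inv_arr C f) = Dom C f"
    "inv_arr C f \<cdot> f = Idn C (Dom C f)" "f \<cdot> inv_arr C f = Idn C (Cod C f)"
    by (auto simp: inverse_arrows_def hom_def)
qed

lemma inv_Cmp' [simp]:
  assumes "iso_arr C f" "g \<in> Arr C" "Cod C g = Dom C f"
  shows "inv_arr C f \<cdot> (f \<cdot> g) = g"
  using assms Cmp_Cmp[of g f "inv_arr C f"] Arr_iso[OF assms(1)] by simp

lemma Cmp_inv' [simp]:
  assumes "iso_arr C f" "g \<in> Arr C" "Cod C g = Cod C f"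
  shows "f \<cdot> (inv_arr C f \<cdot> g) = g"
  using assms Cmp_Cmp[of g "inv_arr C f" f] Arr_iso[OF assms(1)] by simp

lemma iso_arrI:
  "\<lbrakk>f \<in> Arr C; g \<in> Arr C; Dom C g = Cod C f; Cod C g = Dom C f;
    g \<cdot> f = Idn C (Dom C f); f \<cdot> g = Idn C (Cod C f)\<rbrakk> \<Longrightarrow> iso_arr C f"
  unfolding iso_arr_def inverse_arrows_def hom_def by auto

lemma iso_cancel_right:
  assumes "iso_arr C k" "f \<in> Arr C" "g \<in> Arr C" "Dom C f = Cod C k" "Dom C g = Cod C k"
    and eq: "f \<cdot> k = g \<cdot> k"
  shows "f = g"
proof -
  have "(f \<cdot> k) \<cdot> inv_arr C k = (g \<cdot> k) \<cdot> inv_arr C k" by (simp only: eq)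
  then show ?thesis using assms(1-5) Arr_iso[OF assms(1)] by simp
qed

lemma iso_cancel_left:
  assumes "iso_arr C k" "f \<in> Arr C" "g \<in> Arr C" "Cod C f = Dom C k" "Cod C g = Dom C k"
    and eq: "k \<cdot> f = k \<cdot> g"
  shows "f = g"
proof -
  have "inv_arr C k \<cdot> (k \<cdot> f) = inv_arr C k \<cdot> (k \<cdot> g)" by (simp only: eq)
  then show ?thesis using assms(1-5) by simp
qed

end

section \<open>Tensor calculus and coherence of the left unitor\<close>

context monoidal_category
begin

declare Unit_in_Obj [simp] TensObj_in_Obj [simp] TensArr_Idn [simp]
  Assoc_iso [simp] LUnit_iso [simp] RUnit_iso [simp]

lemma
  assumes "f \<in> Arr C" "g \<in> Arr C"
  shows Arr_TensArr [simp]: "f \<odot> g \<in> Arr C"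
    and Dom_TensArr [simp]: "Dom C (f \<odot> g) = Dom C f \<otimes> Dom C g"
    and Cod_TensArr [simp]: "Cod C (f \<odot> g) = Cod C f \<otimes> Cod C g"
  using TensArr_in_hom[of f "Dom C f" "Cod C f" g "Dom C g" "Cod C g"] assms
  by (simp_all add: hom_def)

lemma TensArr_Cmp_TensArr [simp]:
  "\<lbrakk>f \<in> Arr C; f' \<in> Arr C; g \<in> Arr C; g' \<in> Arr C; Dom C f' = Cod C f; Dom C g' = Cod C g\<rbrakk>
    \<Longrightarrow> (f' \<odot> g') \<cdot> (f \<odot> g) = (f' \<cdot> f) \<odot> (g' \<cdot> g)"
  by (rule TensArr_Cmp[symmetric]) (auto simp: hom_def)

lemma TensArr_Cmp_TensArr' [simp]:
  assumes "f \<in> Arr C" "f' \<in> Arr C" "g \<in> Arr C" "g' \<in> Arr C"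
    "Dom C f' = Cod C f" "Dom C g' = Cod C g" "h \<in> Arr C" "Cod C h = Dom C f \<otimes> Dom C g"
  shows "(f' \<odot> g') \<cdot> ((f \<odot> g) \<cdot> h) = ((f' \<cdot> f) \<odot> (g' \<cdot> g)) \<cdot> h"
  using assms Cmp_Cmp[of h "f \<odot> g" "f' \<odot> g'"] by simp

lemma
  assumes "X \<in> Obj C" "Y \<in> Obj C" "Z \<in> Obj C"
  shows Arr_Assoc [simp]: "Assoc C X Y Z \<in> Arr C"
    and Dom_Assoc [simp]: "Dom C (Assoc C X Y Z) = (X \<otimes> Y) \<otimes> Z"
    and Cod_Assoc [simp]: "Cod C (Assoc C X Y Z) = X \<otimes> (Y \<otimes> Z)"
  using Assoc_in_hom[OF assms] by (simp_all add: hom_def)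

lemma
  assumes "X \<in> Obj C"
  shows Arr_LUnit [simp]: "LUnit C X \<in> Arr C"
    and Dom_LUnit [simp]: "Dom C (LUnit C X) = Unit C \<otimes> X"
    and Cod_LUnit [simp]: "Cod C (LUnit C X) = X"
    and Arr_RUnit [simp]: "RUnit C X \<in> Arr C"
    and Dom_RUnit [simp]: "Dom C (RUnit C X) = X \<otimes> Unit C"
    and Cod_RUnit [simp]: "Cod C (RUnit C X) = X"
  using LUnit_in_hom[OF assms] RUnit_in_hom[OF assms] by (simp_all add: hom_def)

lemma Assoc_nat:
  "\<lbrakk>f \<in> Arr C; g \<in> Arr C; h \<in> Arr C; Cod C f = X; Cod C g = Y; Cod C h = Z\<rbrakk>
    \<Longrightarrow> Assoc C X Y Z \<cdot> ((f \<odot> g) \<odot> h)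
      = (f \<odot> (g \<odot> h)) \<cdot> Assoc C (Dom C f) (Dom C g) (Dom C h)"
  by (rule Assoc_natural) (auto simp: hom_def)

lemma LUnit_nat: "f \<in> Arr C \<Longrightarrow> LUnit C (Cod C f) \<cdot> (Idn C (Unit C) \<odot> f) = f \<cdot> LUnit C (Dom C f)"
  by (rule LUnit_natural) (auto simp: hom_def)

lemma RUnit_nat: "f \<in> Arr C \<Longrightarrow> RUnit C (Cod C f) \<cdot> (f \<odot> Idn C (Unit C)) = f \<cdot> RUnit C (Dom C f)"
  by (rule RUnit_natural) (auto simp: hom_def)

lemma iso_TensArr [simp]:
  assumes "iso_arr C f" "iso_arr C g"
  shows "iso_arr C (f \<odot> g)"
  by (rule iso_arrI[where g = "inv_arr C f \<odot> inv_arr C g"]) (use assms Arr_iso in simp_all)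

lemma iso_Idn [simp]: "X \<in> Obj C \<Longrightarrow> iso_arr C (Idn C X)"
  by (rule iso_arrI[where g = "Idn C X"]) simp_all

lemma iso_Cmp [simp]:
  assumes "iso_arr C f" "iso_arr C g" "Dom C g = Cod C f"
  shows "iso_arr C (g \<cdot> f)"
  by (rule iso_arrI[where g = "inv_arr C f \<cdot> inv_arr C g"]) (use assms Arr_iso in simp_all)

lemma iso_inv [simp]:
  assumes "iso_arr C f"
  shows "iso_arr C (inv_arr C f)"
  by (rule iso_arrI[where g = f]) (use assms Arr_iso in simp_all)

text \<open>By naturality of the invertible left unitor, tensoring with the unit is isomorphic to
  the identity functor.\<close>

lemma Unit_tensor_faithful:
  assumes "f \<in> Arr C" "g \<in> Arr C" "Dom C f = Dom C g" "Cod C f = Cod C g"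
    and eq: "Idn C (Unit C) \<odot> f = Idn C (Unit C) \<odot> g"
  shows "f = g"
proof (rule iso_cancel_right)
  show "f \<cdot> LUnit C (Dom C f) = g \<cdot> LUnit C (Dom C f)"
    using LUnit_nat[of f] LUnit_nat[of g] assms by simp
qed (use assms in simp_all)

text \<open>Kelly's argument: tensoring with the unit is faithful, and the tensored equation is the pentagon at
  \<open>I, I, X, Y\<close> combined with two triangles.\<close>

lemma LUnit_Assoc:
  assumes X: "X \<in> Obj C" and Y: "Y \<in> Obj C"
  shows "LUnit C (X \<otimes> Y) \<cdot> Assoc C (Unit C) X Y = LUnit C X \<odot> Idn C Y"
proof (rule Unit_tensor_faithful)
  let ?I = "Unit C" and ?i = "Idn C (Unit C)"
  let ?k = "Assoc C ?I (?I \<otimes> X) Y \<cdot> (Assoc C ?I ?I X \<odot> Idn C Y)"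
  note [simp] = X Y
  have "(?i \<odot> (LUnit C (X \<otimes> Y) \<cdot> Assoc C ?I X Y)) \<cdot> ?k
      = (?i \<odot> LUnit C (X \<otimes> Y)) \<cdot> ((?i \<odot> Assoc C ?I X Y) \<cdot> ?k)"
    by simp
  also have "\<dots> = (?i \<odot> LUnit C (X \<otimes> Y)) \<cdot> (Assoc C ?I ?I (X \<otimes> Y) \<cdot> Assoc C (?I \<otimes> ?I) X Y)"
    by (simp only: pentagon Unit_in_Obj X Y)
  also have "\<dots> = ((?i \<odot> LUnit C (X \<otimes> Y)) \<cdot> Assoc C ?I ?I (X \<otimes> Y)) \<cdot> Assoc C (?I \<otimes> ?I) X Y"
    by simp
  also have "\<dots> = (RUnit C ?I \<odot> (Idn C X \<odot> Idn C Y)) \<cdot> Assoc C (?I \<otimes> ?I) X Y"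
    by (simp only: triangle Unit_in_Obj X Y TensObj_in_Obj TensArr_Idn)
  also have "\<dots> = Assoc C ?I X Y \<cdot> ((RUnit C ?I \<odot> Idn C X) \<odot> Idn C Y)"
    by (subst Assoc_nat) simp_all
  also have "\<dots> = Assoc C ?I X Y \<cdot> (((?i \<odot> LUnit C X) \<odot> Idn C Y) \<cdot> (Assoc C ?I ?I X \<odot> Idn C Y))"
    by (simp add: triangle)
  also have "\<dots> = (Assoc C ?I X Y \<cdot> ((?i \<odot> LUnit C X) \<odot> Idn C Y)) \<cdot> (Assoc C ?I ?I X \<odot> Idn C Y)"
    by (subst Cmp_Cmp) simp_all
  also have "\<dots> = (?i \<odot> (LUnit C X \<odot> Idn C Y)) \<cdot> ?k"
    by (simp add: Assoc_nat)
  finally have eq: "(?i \<odot> (LUnit C (X \<otimes> Y) \<cdot> Assoc C ?I X Y)) \<cdot> ?k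
    = (?i \<odot> (LUnit C X \<odot> Idn C Y)) \<cdot> ?k" .
  show "?i \<odot> (LUnit C (X \<otimes> Y) \<cdot> Assoc C ?I X Y) = ?i \<odot> (LUnit C X \<odot> Idn C Y)"
    by (rule iso_cancel_right[OF _ _ _ _ _ eq]) simp_all
qed (use X Y in simp_all)

end

section \<open>Monoidal categories with terminal unit\<close>

text \<open>Here the tensor has projections, but they need not form a product. This is the situation
  of the forward direction once the unit is terminal; coherence of the projections is proved at this
  level so that both directions can use it.\<close>

locale semicartesian_category = monoidal_category +
  assumes terminal_Unit: "terminal C (Unit C)"
begin

abbreviation discard :: "'a \<Rightarrow> 'b" (\<open>!\<close>) where
  "! X \<equiv> to_terminal C (Unit C) X"

definition p1 :: "'a \<Rightarrow> 'a \<Rightarrow> 'b" where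
  "p1 X Y = RUnit C X \<cdot> (Idn C X \<odot> ! Y)"

definition p2 :: "'a \<Rightarrow> 'a \<Rightarrow> 'b" where
  "p2 X Y = LUnit C Y \<cdot> (! X \<odot> Idn C Y)"

lemma
  assumes "X \<in> Obj C"
  shows Arr_discard [simp]: "! X \<in> Arr C"
    and Dom_discard [simp]: "Dom C (! X) = X"
    and Cod_discard [simp]: "Cod C (! X) = Unit C"
proof -
  have "\<exists>!f. f \<in> hom C X (Unit C)"
    using terminal_Unit assms by (simp add: terminal_def)
  then have "! X \<in> hom C X (Unit C)"
    unfolding to_terminal_def by (rule theI')
  then show "! X \<in> Arr C" "Dom C (! X) = X" "Cod C (! X) = Unit C"
    by (simp_all add: hom_def)
qed

lemma to_Unit_unique:
  assumes "f \<in> Arr C" "g \<in> Arr C" "Dom C f = Dom C g" "Cod C f = Unit C" "Cod C g = Unit C"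
  shows "f = g"
proof -
  have "\<exists>!h. h \<in> hom C (Dom C f) (Unit C)"
    using terminal_Unit assms by (simp add: terminal_def)
  moreover have "f \<in> hom C (Dom C f) (Unit C)" "g \<in> hom C (Dom C f) (Unit C)"
    using assms by (simp_all add: hom_def)
  ultimately show ?thesis by blast
qed

lemma discard_Cmp [simp]: "f \<in> Arr C \<Longrightarrow> Cod C f = X \<Longrightarrow> ! X \<cdot> f = ! (Dom C f)"
  by (rule to_Unit_unique) auto

lemma discard_Unit [simp]: "! (Unit C) = Idn C (Unit C)"
  by (rule to_Unit_unique) simp_all

lemma
  assumes "X \<in> Obj C" "Y \<in> Obj C"
  shows Arr_p1 [simp]: "p1 X Y \<in> Arr C"
    and Dom_p1 [simp]: "Dom C (p1 X Y) = X \<otimes> Y"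
    and Cod_p1 [simp]: "Cod C (p1 X Y) = X"
    and Arr_p2 [simp]: "p2 X Y \<in> Arr C"
    and Dom_p2 [simp]: "Dom C (p2 X Y) = X \<otimes> Y"
    and Cod_p2 [simp]: "Cod C (p2 X Y) = Y"
  using assms by (simp_all add: p1_def p2_def)

text \<open>Terminality absorbs \<open>g\<close> into the discarding map, and naturality of the
  right unitor moves \<open>f\<close> across. As a rewrite rule it pushes projections to the
  right.\<close>

lemma p1_TensArr [simp]:
  assumes "f \<in> Arr C" "g \<in> Arr C" "Cod C f = X" "Cod C g = Y"
  shows "p1 X Y \<cdot> (f \<odot> g) = f \<cdot> p1 (Dom C f) (Dom C g)"
proof -
  have [simp]: "X \<in> Obj C" "Y \<in> Obj C"
    using assms by auto
  have "p1 X Y \<cdot> (f \<odot> g) = (RUnit C X \<cdot> (f \<odot> Idn C (Unit C))) \<cdot> (Idn C (Dom C f) \<odot> ! (Dom C g))"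
    using assms by (simp add: p1_def)
  also have "\<dots> = f \<cdot> p1 (Dom C f) (Dom C g)"
    using assms RUnit_nat[of f] by (simp add: p1_def del: TensArr_Cmp_TensArr TensArr_Cmp_TensArr')
  finally show ?thesis .
qed

lemma p2_TensArr [simp]:
  assumes "f \<in> Arr C" "g \<in> Arr C" "Cod C f = X" "Cod C g = Y"
  shows "p2 X Y \<cdot> (f \<odot> g) = g \<cdot> p2 (Dom C f) (Dom C g)"
proof -
  have [simp]: "X \<in> Obj C" "Y \<in> Obj C"
    using assms by auto
  have "p2 X Y \<cdot> (f \<odot> g) = (LUnit C Y \<cdot> (Idn C (Unit C) \<odot> g)) \<cdot> (! (Dom C f) \<odot> Idn C (Dom C g))"
    using assms by (simp add: p2_def)
  also have "\<dots> = g \<cdot> p2 (Dom C f) (Dom C g)"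
    using assms LUnit_nat[of g] by (simp add: p2_def del: TensArr_Cmp_TensArr TensArr_Cmp_TensArr')
  finally show ?thesis .
qed

lemma p1_TensArr' [simp]:
  assumes "f \<in> Arr C" "g \<in> Arr C" "Cod C f = X" "Cod C g = Y" "h \<in> Arr C" "Cod C h = Dom C f \<otimes> Dom C g"
  shows "p1 X Y \<cdot> ((f \<odot> g) \<cdot> h) = f \<cdot> (p1 (Dom C f) (Dom C g) \<cdot> h)"
  using Cmp_reassoc[OF p1_TensArr[OF assms(1-4)], of h] assms by auto

lemma p2_TensArr' [simp]:
  assumes "f \<in> Arr C" "g \<in> Arr C" "Cod C f = X" "Cod C g = Y" "h \<in> Arr C" "Cod C h = Dom C f \<otimes> Dom C g"
  shows "p2 X Y \<cdot> ((f \<odot> g) \<cdot> h) = g \<cdot> (p2 (Dom C f) (Dom C g) \<cdot> h)"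
  using Cmp_reassoc[OF p2_TensArr[OF assms(1-4)], of h] assms by auto

text \<open>The only endomorphism of the unit is its identity, so the unitors are themselves
  projections. This turns unit laws into statements about projections.\<close>

lemma RUnit_eq_p1: "X \<in> Obj C \<Longrightarrow> RUnit C X = p1 X (Unit C)"
  by (simp add: p1_def)

lemma LUnit_eq_p2: "X \<in> Obj C \<Longrightarrow> LUnit C X = p2 (Unit C) X"
  by (simp add: p2_def)

text \<open>Naturality of the associator moves the discarding of \<open>X\<close> inside, and
  \<open>LUnit_Assoc\<close> removes the unit left behind.\<close>

lemma p2_Assoc [simp]:
  assumes [simp]: "X \<in> Obj C" "Y \<in> Obj C" "Z \<in> Obj C"
  shows "p2 X (Y \<otimes> Z) \<cdot> Assoc C X Y Z = p2 X Y \<odot> Idn C Z"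
proof -
  have "p2 X (Y \<otimes> Z) \<cdot> Assoc C X Y Z
      = LUnit C (Y \<otimes> Z) \<cdot> ((! X \<odot> (Idn C Y \<odot> Idn C Z)) \<cdot> Assoc C X Y Z)"
    by (simp add: p2_def)
  also have "\<dots> = LUnit C (Y \<otimes> Z) \<cdot> (Assoc C (Unit C) Y Z \<cdot> ((! X \<odot> Idn C Y) \<odot> Idn C Z))"
    by (subst Assoc_nat) simp_all
  also have "\<dots> = (LUnit C Y \<odot> Idn C Z) \<cdot> ((! X \<odot> Idn C Y) \<odot> Idn C Z)"
    by (rule Cmp_reassoc[OF LUnit_Assoc]) simp_all
  also have "\<dots> = p2 X Y \<odot> Idn C Z"
    by (simp add: p2_def)
  finally show ?thesis .
qed

text \<open>The same argument with the middle factor discarded, the triangle taking the place of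
  \<open>LUnit_Assoc\<close>.\<close>

lemma Idn_p2_Assoc [simp]:
  assumes [simp]: "X \<in> Obj C" "Y \<in> Obj C" "Z \<in> Obj C"
  shows "(Idn C X \<odot> p2 Y Z) \<cdot> Assoc C X Y Z = p1 X Y \<odot> Idn C Z"
proof -
  have "(Idn C X \<odot> p2 Y Z) \<cdot> Assoc C X Y Z
      = (Idn C X \<odot> LUnit C Z) \<cdot> ((Idn C X \<odot> (! Y \<odot> Idn C Z)) \<cdot> Assoc C X Y Z)"
    by (simp add: p2_def)
  also have "\<dots> = (Idn C X \<odot> LUnit C Z) \<cdot> (Assoc C X (Unit C) Z \<cdot> ((Idn C X \<odot> ! Y) \<odot> Idn C Z))"
    by (subst Assoc_nat) (simp_all del: TensArr_Idn)
  also have "\<dots> = (RUnit C X \<odot> Idn C Z) \<cdot> ((Idn C X \<odot> ! Y) \<odot> Idn C Z)"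
    by (rule Cmp_reassoc[OF triangle]) simp_all
  also have "\<dots> = p1 X Y \<odot> Idn C Z"
    by (simp add: p1_def)
  finally show ?thesis .
qed

text \<open>Discarding \<open>Y \<otimes> Z\<close> in two stages, first \<open>Y\<close> and then
  \<open>Z\<close>, reduces this to \<open>Idn_p2_Assoc\<close>.\<close>

lemma p1_Assoc [simp]:
  assumes [simp]: "X \<in> Obj C" "Y \<in> Obj C" "Z \<in> Obj C"
  shows "p1 X (Y \<otimes> Z) \<cdot> Assoc C X Y Z = p1 X Y \<cdot> p1 (X \<otimes> Y) Z"
proof -
  have "p1 X (Y \<otimes> Z) = p1 X Z \<cdot> (Idn C X \<odot> p2 Y Z)"
    by simp
  then have "p1 X (Y \<otimes> Z) \<cdot> Assoc C X Y Z = p1 X Z \<cdot> ((Idn C X \<odot> p2 Y Z) \<cdot> Assoc C X Y Z)"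
    by (simp del: p1_TensArr p1_TensArr' Idn_p2_Assoc)
  also have "\<dots> = p1 X Y \<cdot> p1 (X \<otimes> Y) Z"
    by simp
  finally show ?thesis .
qed

lemma p2_inv_Assoc [simp]:
  assumes [simp]: "X \<in> Obj C" "Y \<in> Obj C" "Z \<in> Obj C"
  shows "p2 (X \<otimes> Y) Z \<cdot> inv_arr C (Assoc C X Y Z) = p2 Y Z \<cdot> p2 X (Y \<otimes> Z)"
  by (rule iso_cancel_right[of "Assoc C X Y Z"]) simp_all

lemma p1_Idn_inv_Assoc [simp]:
  assumes [simp]: "X \<in> Obj C" "Y \<in> Obj C" "Z \<in> Obj C"
  shows "(p1 X Y \<odot> Idn C Z) \<cdot> inv_arr C (Assoc C X Y Z) = Idn C X \<odot> p2 Y Z"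
  by (rule iso_cancel_right[of "Assoc C X Y Z"]) simp_all

lemma p1_p1_inv_Assoc [simp]:
  assumes [simp]: "X \<in> Obj C" "Y \<in> Obj C" "Z \<in> Obj C"
  shows "p1 X Y \<cdot> (p1 (X \<otimes> Y) Z \<cdot> inv_arr C (Assoc C X Y Z)) = p1 X (Y \<otimes> Z)"
  by (rule iso_cancel_right[of "Assoc C X Y Z"]) simp_all

lemma p2_p1_inv_Assoc [simp]:
  assumes [simp]: "X \<in> Obj C" "Y \<in> Obj C" "Z \<in> Obj C"
  shows "p2 X Y \<cdot> (p1 (X \<otimes> Y) Z \<cdot> inv_arr C (Assoc C X Y Z)) = p1 Y Z \<cdot> p2 X (Y \<otimes> Z)"
  by (rule iso_cancel_right[of "Assoc C X Y Z"]) simp_all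

end

section \<open>The symmetry, the interchange map and their projections\<close>

context symmetric_monoidal_category
begin

lemma
  assumes "X \<in> Obj C" "Y \<in> Obj C"
  shows Arr_Symm [simp]: "Symm C X Y \<in> Arr C"
    and Dom_Symm [simp]: "Dom C (Symm C X Y) = X \<otimes> Y"
    and Cod_Symm [simp]: "Cod C (Symm C X Y) = Y \<otimes> X"
  using Symm_in_hom[OF assms] by (simp_all add: hom_def)

lemma Symm_nat:
  "\<lbrakk>f \<in> Arr C; g \<in> Arr C; Cod C f = X; Cod C g = Y\<rbrakk>
    \<Longrightarrow> Symm C X Y \<cdot> (f \<odot> g) = (g \<odot> f) \<cdot> Symm C (Dom C f) (Dom C g)"
  by (rule Symm_natural) (auto simp: hom_def)

lemma iso_Symm [simp]: "X \<in> Obj C \<Longrightarrow> Y \<in> Obj C \<Longrightarrow> iso_arr C (Symm C X Y)"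
  by (rule iso_arrI[of _ "Symm C Y X"]) (simp_all add: Symm_Symm)

lemma
  assumes [simp]: "A \<in> Obj C" "B \<in> Obj C" "A' \<in> Obj C" "B' \<in> Obj C"
  shows Arr_interchange [simp]: "interchange C A B A' B' \<in> Arr C"
    and Dom_interchange [simp]: "Dom C (interchange C A B A' B') = (A \<otimes> B) \<otimes> (A' \<otimes> B')"
    and Cod_interchange [simp]: "Cod C (interchange C A B A' B') = (A \<otimes> A') \<otimes> (B \<otimes> B')"
    and iso_interchange [simp]: "iso_arr C (interchange C A B A' B')"
  unfolding interchange_def by simp_all

end

locale semicartesian_symmetric_category = symmetric_monoidal_category + semicartesian_category
begin

lemma p2_Symm [simp]:
  assumes [simp]: "X \<in> Obj C" "Y \<in> Obj C"
  shows "p2 Y X \<cdot> Symm C X Y = p1 X Y"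
proof -
  have "p2 Y X \<cdot> Symm C X Y = LUnit C X \<cdot> ((! Y \<odot> Idn C X) \<cdot> Symm C X Y)"
    by (simp add: p2_def)
  also have "\<dots> = LUnit C X \<cdot> (Symm C X (Unit C) \<cdot> (Idn C X \<odot> ! Y))"
    by (subst Symm_nat) simp_all
  also have "\<dots> = RUnit C X \<cdot> (Idn C X \<odot> ! Y)"
    by (rule Cmp_reassoc[OF Symm_unit]) simp_all
  finally show ?thesis by (simp add: p1_def)
qed

lemma p1_Symm [simp]:
  assumes [simp]: "X \<in> Obj C" "Y \<in> Obj C"
  shows "p1 Y X \<cdot> Symm C X Y = p2 X Y"
proof -
  have "p1 Y X \<cdot> Symm C X Y = p2 X Y \<cdot> (Symm C Y X \<cdot> Symm C X Y)"
    using Cmp_reassoc[OF p2_Symm[of Y X], of "Symm C X Y"] by simp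
  then show ?thesis by (simp add: Symm_Symm)
qed

text \<open>\<open>A\<close> and \<open>A'\<close> are discarded one after the other; the second
  discarding passes the symmetry by \<open>p2_Symm\<close> and then the inner inverse associator. No
  pairing is involved, so the forward direction can use this.\<close>

lemma p2_interchange:
  assumes [simp]: "A \<in> Obj C" "B \<in> Obj C" "A' \<in> Obj C" "B' \<in> Obj C"
  shows "p2 (A \<otimes> A') (B \<otimes> B') \<cdot> interchange C A B A' B' = p2 A B \<odot> p2 A' B'"
proof -
  let ?k = "Assoc C A B (A' \<otimes> B')"
  have "p2 (A \<otimes> A') (B \<otimes> B') \<cdot> interchange C A B A' B'
      = p2 A' (B \<otimes> B') \<cdot> (Assoc C A' B B' \<cdot> ((Symm C B A' \<odot> Idn C B')
          \<cdot> (inv_arr C (Assoc C B A' B') \<cdot> (p2 A (B \<otimes> (A' \<otimes> B')) \<cdot> ?k))))"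
    unfolding interchange_def by (simp add: Cmp_reassoc[OF p2_inv_Assoc] del: p2_Assoc)
  also have "\<dots> = (p1 B A' \<odot> Idn C B') \<cdot> (inv_arr C (Assoc C B A' B') \<cdot> (p2 A B \<odot> Idn C (A' \<otimes> B')))"
    by (simp add: Cmp_reassoc[OF p2_Assoc])
  also have "\<dots> = p2 A B \<odot> p2 A' B'"
    by (simp add: Cmp_reassoc[OF p1_Idn_inv_Assoc])
  finally show ?thesis .
qed

text \<open>The mixed projection suffices for the forward direction and, unlike
  \<open>p1_interchange\<close> below, is obtained without a universal property.\<close>

lemma p1_p2_interchange:
  assumes [simp]: "A \<in> Obj C" "B \<in> Obj C" "A' \<in> Obj C" "B' \<in> Obj C"
  shows "(p1 A A' \<odot> p2 B B') \<cdot> interchange C A B A' B' = p1 A B \<odot> p2 A' B'"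
proof -
  \<comment> \<open>Splitting the tensor of projections into two stages exposes
    \<open>p1 A A' \<odot> Idn C (B \<otimes> B')\<close>, the shape that passes the inverse
    associator.\<close>
  have "(p1 A A' \<odot> p2 B B') \<cdot> inv_arr C (Assoc C A A' (B \<otimes> B'))
      = (Idn C A \<odot> p2 B B') \<cdot> ((p1 A A' \<odot> Idn C (B \<otimes> B')) \<cdot> inv_arr C (Assoc C A A' (B \<otimes> B')))"
    by (simp del: p1_Idn_inv_Assoc)
  also have "\<dots> = Idn C A \<odot> (p2 B B' \<cdot> p2 A' (B \<otimes> B'))"
    by simp
  finally have eq: "(p1 A A' \<odot> p2 B B') \<cdot> inv_arr C (Assoc C A A' (B \<otimes> B'))
    = Idn C A \<odot> (p2 B B' \<cdot> p2 A' (B \<otimes> B'))" .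
  have "(p1 A A' \<odot> p2 B B') \<cdot> interchange C A B A' B'
    = (Idn C A \<odot> p2 B B') \<cdot> ((Idn C A \<odot> p2 A' (B \<otimes> B'))
      \<cdot> ((Idn C A \<odot> Assoc C A' B B') \<cdot> ((Idn C A \<odot> (Symm C B A' \<odot> Idn C B'))
      \<cdot> ((Idn C A \<odot> inv_arr C (Assoc C B A' B')) \<cdot> Assoc C A B (A' \<otimes> B')))))"
    unfolding interchange_def by (simp add: Cmp_reassoc[OF eq])
  also have "\<dots> = (Idn C A \<odot> p2 A' B') \<cdot> ((Idn C A \<odot> p2 B (A' \<otimes> B')) \<cdot> Assoc C A B (A' \<otimes> B'))"
    by (simp add: Cmp_reassoc[OF p2_Assoc] del: Idn_p2_Assoc)
  also have "\<dots> = p1 A B \<odot> p2 A' B'"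
    by simp
  finally show ?thesis .
qed

end

section \<open>The comonad structure forces cartesianness\<close>

lemma seq_cat_simps [simp]:
  "Obj (seq_cat C) = {X. \<forall>n. X n \<in> Obj C}"
  "Arr (seq_cat C) = {f. \<forall>n. f n \<in> Arr C}"
  "Dom (seq_cat C) f = (\<lambda>n. Dom C (f n))"
  "Cod (seq_cat C) f = (\<lambda>n. Cod C (f n))"
  "Idn (seq_cat C) X = (\<lambda>n. Idn C (X n))"
  "g \<cdot>\<^bsub>seq_cat C\<^esub> f = (\<lambda>n. g n \<cdot>\<^bsub>C\<^esub> f n)"
  "X \<otimes>\<^bsub>seq_cat C\<^esub> Y = (\<lambda>n. X n \<otimes>\<^bsub>C\<^esub> Y n)"
  "f \<odot>\<^bsub>seq_cat C\<^esub> g = (\<lambda>n. f n \<odot>\<^bsub>C\<^esub> g n)"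
  "Unit (seq_cat C) = (\<lambda>n. Unit C)"
  "Assoc (seq_cat C) X Y Z = (\<lambda>n. Assoc C (X n) (Y n) (Z n))"
  "LUnit (seq_cat C) X = (\<lambda>n. LUnit C (X n))"
  "RUnit (seq_cat C) X = (\<lambda>n. RUnit C (X n))"
  by (simp_all add: seq_cat_def)

lemma hom_seq_cat: "f \<in> hom (seq_cat C) X Y \<longleftrightarrow> (\<forall>n. f n \<in> hom C (X n) (Y n))"
  by (auto simp: hom_def fun_eq_iff)

lemma hom_seq_iff:
  "f \<in> hom (seq_cat C) X Y \<longleftrightarrow> (\<forall>n. f n \<in> Arr C \<and> Dom C (f n) = X n \<and> Cod C (f n) = Y n)"
  by (auto simp: hom_def fun_eq_iff)

lemma ListPlus_simps [simp]:
  "FObj (ListPlus C) = list_obj C"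
  "FArr (ListPlus C) = list_arr C"
  "OpUnit (ListPlus C) = list_op_unit C"
  "OpTens (ListPlus C) = list_op_tens C"
  by (simp_all add: ListPlus_def)

lemma id_oplax_simps [simp]:
  "FObj (id_oplax C) X = X"
  "FArr (id_oplax C) f = f"
  "OpUnit (id_oplax C) = Idn C (Unit C)"
  "OpTens (id_oplax C) X Y = Idn C (X \<otimes>\<^bsub>C\<^esub> Y)"
  by (simp_all add: id_oplax_def)

lemma comp_oplax_simps [simp]:
  "FObj (comp_oplax E G F) X = FObj G (FObj F X)"
  "FArr (comp_oplax E G F) f = FArr G (FArr F f)"
  "OpUnit (comp_oplax E G F) = OpUnit G \<cdot>\<^bsub>E\<^esub> FArr G (OpUnit F)"
  "OpTens (comp_oplax E G F) X Y = OpTens G (FObj F X) (FObj F Y) \<cdot>\<^bsub>E\<^esub> FArr G (OpTens F X Y)"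
  by (simp_all add: comp_oplax_def)

locale ListPlus_comonad = symmetric_monoidal_category +
  fixes \<epsilon> \<delta>
  assumes comonad: "oplax_monoidal_comonad (seq_cat C) (ListPlus C) \<epsilon> \<delta>"
begin

interpretation L: oplax_monoidal_comonad "seq_cat C" "ListPlus C" \<epsilon> \<delta>
  by (rule comonad)

lemma
  assumes "\<And>n. X n \<in> Obj C"
  shows Arr_eps [simp]: "\<epsilon> X n \<in> Arr C"
    and Dom_eps [simp]: "Dom C (\<epsilon> X n) = list_obj C X n"
    and Cod_eps [simp]: "Cod C (\<epsilon> X n) = X n"
    and Arr_delta [simp]: "\<delta> X n \<in> Arr C"
    and Dom_delta [simp]: "Dom C (\<delta> X n) = list_obj C X n"
    and Cod_delta [simp]: "Cod C (\<delta> X n) = list_obj C (list_obj C X) n"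
  using L.counit.component_in_hom[of X] L.comult.component_in_hom[of X] assms
  by (simp_all add: hom_def fun_eq_iff)

lemma eps_natural:
  "(\<And>n. f n \<in> hom C (X n) (Y n)) \<Longrightarrow> \<epsilon> Y n \<cdot> list_arr C f n = f n \<cdot> \<epsilon> X n"
  using L.counit.natural[of f X Y] by (simp add: hom_seq_cat fun_eq_iff)

lemma delta_natural:
  "(\<And>n. f n \<in> hom C (X n) (Y n))
    \<Longrightarrow> \<delta> Y n \<cdot> list_arr C f n = list_arr C (list_arr C f) n \<cdot> \<delta> X n"
  using L.comult.natural[of f X Y] by (simp add: hom_seq_cat fun_eq_iff)

lemma eps_Unit: "\<epsilon> (\<lambda>n. Unit C) n = list_op_unit C n"
  using L.counit.monoidal_unit by (simp add: fun_eq_iff)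

lemma delta_tensor:
  assumes "\<And>n. X n \<in> Obj C" "\<And>n. Y n \<in> Obj C"
  shows "(list_op_tens C (list_obj C X) (list_obj C Y) n \<cdot> list_arr C (list_op_tens C X Y) n)
      \<cdot> \<delta> (\<lambda>n. X n \<otimes> Y n) n = (\<delta> X n \<odot> \<delta> Y n) \<cdot> list_op_tens C X Y n"
  using L.comult.monoidal_tensor[of X Y] assms by (simp add: fun_eq_iff)

lemma counit_left: "(\<And>n. X n \<in> Obj C) \<Longrightarrow> \<epsilon> (list_obj C X) n \<cdot> \<delta> X n = Idn C (list_obj C X n)"
  using L.comonad_counit_left[of X] by (simp add: fun_eq_iff)

lemma counit_right:
  "(\<And>n. X n \<in> Obj C) \<Longrightarrow> list_arr C (\<epsilon> X) n \<cdot> \<delta> X n = Idn C (list_obj C X n)"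
  using L.comonad_counit_right[of X] by (simp add: fun_eq_iff)

text \<open>In degree 1 the list object of this sequence is X \<otimes> I, a copy of
  \<open>X\<close> up to the right unitor, and \<delta> maps it to X \<otimes> (X \<otimes>
  I).\<close>

abbreviation pad :: "'a \<Rightarrow> nat \<Rightarrow> 'a" where
  "pad X \<equiv> case_nat X (\<lambda>_. Unit C)"

lemma pad_Obj [simp]: "X \<in> Obj C \<Longrightarrow> pad X n \<in> Obj C"
  by (simp split: nat.split)

lemma Unit_terminal: "terminal C (Unit C)"
proof -
  define d where "d X = \<epsilon> (pad X) (Suc 0) \<cdot> inv_arr C (RUnit C X)" for X
  have d: "d X \<in> hom C X (Unit C)" if "X \<in> Obj C" for X
    using that by (simp add: d_def hom_def)
  have "f = d X" if X: "X \<in> Obj C" and f: "f \<in> hom C X (Unit C)" for X f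
  proof -
    have [simp]: "f \<in> Arr C" "Dom C f = X" "Cod C f = Unit C" "X \<in> Obj C"
      using f X by (auto simp: hom_def)
    \<comment> \<open>This is the unit of the sequence category, so monoidality of \<epsilon>
      applies: by \<open>eps_Unit\<close> the component in degree 1 is the right unitor of the
      unit.\<close>
    have [simp]: "pad (Unit C) = (\<lambda>n. Unit C)"
      by (simp add: fun_eq_iff split: nat.split)
    have "\<epsilon> (pad (Unit C)) (Suc 0) \<cdot> (f \<odot> Idn C (Unit C)) = Idn C (Unit C) \<cdot> \<epsilon> (pad X) (Suc 0)"
      using eps_natural[of "case_nat f (\<lambda>_. Idn C (Unit C))" "pad X" "pad (Unit C)" "Suc 0"]
      by (simp add: hom_def split: nat.splits)
    then have "f \<cdot> RUnit C X = \<epsilon> (pad X) (Suc 0)"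
      using RUnit_nat[of f] by (simp add: eps_Unit)
    then have "(f \<cdot> RUnit C X) \<cdot> inv_arr C (RUnit C X) = d X"
      by (simp add: d_def)
    then show ?thesis by simp
  qed
  with d show ?thesis
    unfolding terminal_def by (metis Unit_in_Obj)
qed

end

sublocale ListPlus_comonad \<subseteq> semicartesian_symmetric_category
  by unfold_locales (rule Unit_terminal)

section \<open>Existence and uniqueness of pairings\<close>

context ListPlus_comonad
begin

text \<open>By the right counit law, the tensor of \<epsilon> in degrees 0 and 1 is a retraction of
  \<delta> in degree 1; this is its first projection. The right-hand side is the right unitor, hence
  invertible.\<close>

lemma left_inverse_p1_delta:
  assumes [simp]: "X \<in> Obj C"
  shows "\<epsilon> (pad X) 0 \<cdot> (p1 X (X \<otimes> Unit C) \<cdot> \<delta> (pad X) (Suc 0)) = p1 X (Unit C)"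
proof -
  have "\<epsilon> (pad X) 0 \<cdot> (p1 X (X \<otimes> Unit C) \<cdot> \<delta> (pad X) (Suc 0))
      = p1 X (Unit C) \<cdot> ((\<epsilon> (pad X) 0 \<odot> \<epsilon> (pad X) (Suc 0)) \<cdot> \<delta> (pad X) (Suc 0))"
    by simp
  then show ?thesis
    using counit_right[of "pad X" "Suc 0"] by (simp del: p1_TensArr p1_TensArr')
qed

text \<open>The left counit law uses \<epsilon> at the list sequence, an arrow from X \<otimes> (X
  \<otimes> I) to X \<otimes> I. Naturality shows that it factors through \<open>p2\<close>; the
  other factor is the retraction, up to the right unitor.\<close>

lemma left_inverse_p2_delta:
  assumes [simp]: "X \<in> Obj C"
  obtains e where "e \<in> hom C X X"
    "e \<cdot> (p1 X (Unit C) \<cdot> (p2 X (X \<otimes> Unit C) \<cdot> \<delta> (pad X) (Suc 0))) = p1 X (Unit C)"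
proof -
  let ?L = "list_obj C (pad X)"
  \<comment> \<open>Target of the sequence morphism that discards degree 0 of the list sequence and
    is the identity in all other degrees.\<close>
  define W where "W = case_nat (Unit C) (\<lambda>n. ?L (Suc n))"
  let ?r = "RUnit C X"
  define g where "g = \<epsilon> W (Suc 0) \<cdot> inv_arr C (LUnit C (X \<otimes> Unit C))"
  have [simp]: "?L n \<in> Obj C" for n
    by (induction n) simp_all
  have [simp]: "W 0 = Unit C" "W (Suc n) = ?L n \<otimes> Unit C" for n
    by (simp_all add: W_def)
  have [simp]: "W n \<in> Obj C" for n
    by (cases n) simp_all
  have [simp]: "g \<in> Arr C" "Dom C g = X \<otimes> Unit C" "Cod C g = X \<otimes> Unit C"
    by (simp_all add: g_def)
  have "\<epsilon> W (Suc 0) \<cdot> (! X \<odot> Idn C (X \<otimes> Unit C)) = Idn C (X \<otimes> Unit C) \<cdot> \<epsilon> ?L (Suc 0)"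
    using eps_natural[of "case_nat (! X) (\<lambda>n. Idn C (?L (Suc n)))" ?L W "Suc 0"]
    by (simp add: hom_def split: nat.splits)
  then have "\<epsilon> ?L (Suc 0) = g \<cdot> p2 X (X \<otimes> Unit C)"
    by (simp add: g_def p2_def)
  then have g: "g \<cdot> (p2 X (X \<otimes> Unit C) \<cdot> \<delta> (pad X) (Suc 0)) = Idn C (X \<otimes> Unit C)"
    using counit_left[of "pad X" "Suc 0"] by simp
  show thesis
  proof (rule that)
    \<comment> \<open>\<open>g\<close> acts on X \<otimes> I; conjugation with the right unitor
      gives an endomorphism of \<open>X\<close>.\<close>
    show "?r \<cdot> (g \<cdot> inv_arr C ?r) \<in> hom C X X"
      by (simp add: hom_def)
    show "(?r \<cdot> (g \<cdot> inv_arr C ?r)) \<cdot> (p1 X (Unit C) \<cdot> (p2 X (X \<otimes> Unit C) \<cdot> \<delta> (pad X) (Suc 0)))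
      = p1 X (Unit C)"
      using g by (simp flip: RUnit_eq_p1)
  qed
qed

lemma pairing_exists:
  assumes f: "f \<in> hom C Z X" and g: "g \<in> hom C Z Y"
  shows "\<exists>h. h \<in> hom C Z (X \<otimes> Y) \<and> p1 X Y \<cdot> h = f \<and> p2 X Y \<cdot> h = g"
proof -
  have [simp]: "f \<in> Arr C" "Dom C f = Z" "Cod C f = X" "g \<in> Arr C" "Dom C g = Z" "Cod C g = Y"
    using f g by (auto simp: hom_def)
  have [simp]: "X \<in> Obj C" "Y \<in> Obj C" "Z \<in> Obj C"
    using Cod_Obj[of f] Cod_Obj[of g] Dom_Obj[of f] by simp_all
  obtain e where e: "e \<in> hom C Z Z"
    "e \<cdot> (p1 Z (Unit C) \<cdot> (p2 Z (Z \<otimes> Unit C) \<cdot> \<delta> (pad Z) (Suc 0))) = p1 Z (Unit C)"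
    using left_inverse_p2_delta[of Z] by auto
  have [simp]: "e \<in> Arr C" "Dom C e = Z" "Cod C e = Z"
    using e(1) by (auto simp: hom_def)
  let ?i = "inv_arr C (p1 Z (Unit C))"
  have iso [simp]: "iso_arr C (p1 Z (Unit C))"
    by (simp flip: RUnit_eq_p1)
  \<comment> \<open>The components of \<delta> are not known to be identities, so their retractions
    \<open>\<epsilon> (pad Z) 0\<close> and \<open>e\<close> undo them before \<open>f\<close> and
    \<open>g\<close> are applied.\<close>
  let ?h = "((f \<cdot> \<epsilon> (pad Z) 0) \<odot> (g \<cdot> (e \<cdot> p1 Z (Unit C)))) \<cdot> (\<delta> (pad Z) (Suc 0) \<cdot> ?i)"
  have "p1 X Y \<cdot> ?h = f \<cdot> ((\<epsilon> (pad Z) 0 \<cdot> (p1 Z (Z \<otimes> Unit C) \<cdot> \<delta> (pad Z) (Suc 0))) \<cdot> ?i)"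
    by simp
  also have "\<dots> = f"
    by (simp only: left_inverse_p1_delta[OF \<open>Z \<in> Obj C\<close>] Cmp_inv[OF iso]) simp
  finally have 1: "p1 X Y \<cdot> ?h = f" .
  have "p2 X Y \<cdot> ?h
      = g \<cdot> ((e \<cdot> (p1 Z (Unit C) \<cdot> (p2 Z (Z \<otimes> Unit C) \<cdot> \<delta> (pad Z) (Suc 0)))) \<cdot> ?i)"
    by simp
  also have "\<dots> = g"
    by (simp only: e(2) Cmp_inv[OF iso]) simp
  finally have 2: "p2 X Y \<cdot> ?h = g" .
  have "?h \<in> hom C Z (X \<otimes> Y)"
    by (simp add: hom_def)
  with 1 2 show ?thesis by blast
qed

text \<open>
  Monoidality of \<open>\<delta>\<close> at \<open>(X, I, I, \<dots>)\<close> and \<open>(Y, I, I, \<dots>)\<close> says that the copying map of \<open>X \<otimes> Y\<close>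
  followed by \<open>p1 \<odot> p2\<close> is a split monomorphism; naturality of \<open>\<delta>\<close> then recovers any \<open>h\<close>
  from its two projections.
\<close>

lemma projections_jointly_monic:
  assumes "h \<in> hom C Z (X \<otimes> Y)" "h' \<in> hom C Z (X \<otimes> Y)" and [simp]: "X \<in> Obj C" "Y \<in> Obj C"
    and p1: "p1 X Y \<cdot> h = p1 X Y \<cdot> h'" and p2: "p2 X Y \<cdot> h = p2 X Y \<cdot> h'"
  shows "h = h'"
proof -
  let ?I = "Unit C"
  let ?int = "interchange C X Y ?I ?I"
  let ?XY = "\<lambda>n. pad X n \<otimes> pad Y n"
  \<comment> \<open>The tails of \<open>pad Z\<close> and \<open>?XY\<close> consist of I and of I
    \<otimes> I; this isomorphism extends an arrow from \<open>Z\<close> to X \<otimes> Y to a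
    morphism of sequences.\<close>
  let ?j = "inv_arr C (LUnit C ?I)"
  define s where "s = p1 X (X \<otimes> ?I) \<cdot> \<delta> (pad X) (Suc 0)"
  define t where "t = p1 Y ?I \<cdot> (p2 Y (Y \<otimes> ?I) \<cdot> \<delta> (pad Y) (Suc 0))"
  have [simp]: "s \<in> Arr C" "Dom C s = X \<otimes> ?I" "Cod C s = X"
    "t \<in> Arr C" "Dom C t = Y \<otimes> ?I" "Cod C t = Y"
    by (simp_all add: s_def t_def)
  have [simp]: "h \<in> Arr C" "Dom C h = Z" "Cod C h = X \<otimes> Y"
    "h' \<in> Arr C" "Dom C h' = Z" "Cod C h' = X \<otimes> Y"
    using assms by (auto simp: hom_def)
  have [simp]: "Z \<in> Obj C"
    using Dom_Obj[of h] by simp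
  \<comment> \<open>Copying on X \<otimes> Y, with the first copy projected to \<open>X\<close> and
    the second to \<open>Y\<close>. Monoidality of \<delta> expresses it by the separate components
    \<open>s\<close> and \<open>t\<close>.\<close>
  define c where "c = (p1 X Y \<odot> (p2 X Y \<cdot> p1 (X \<otimes> Y) (?I \<otimes> ?I))) \<cdot> \<delta> ?XY (Suc 0)"
  have c: "c = (s \<odot> t) \<cdot> ?int"
  proof -
    have D: "interchange C X Y (X \<otimes> ?I) (Y \<otimes> ?I) \<cdot> ((Idn C (X \<otimes> Y) \<odot> ?int) \<cdot> \<delta> ?XY (Suc 0))
      = (\<delta> (pad X) (Suc 0) \<odot> \<delta> (pad Y) (Suc 0)) \<cdot> ?int"
      using delta_tensor[of "pad X" "pad Y" "Suc 0"] by simp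
    have "(s \<odot> t) \<cdot> ?int = (Idn C X \<odot> p1 Y ?I) \<cdot> ((p1 X (X \<otimes> ?I) \<odot> p2 Y (Y \<otimes> ?I)) \<cdot>
        ((\<delta> (pad X) (Suc 0) \<odot> \<delta> (pad Y) (Suc 0)) \<cdot> ?int))"
      by (simp add: s_def t_def)
    also have "\<dots> = (Idn C X \<odot> p1 Y ?I) \<cdot> (((p1 X (X \<otimes> ?I) \<odot> p2 Y (Y \<otimes> ?I)) \<cdot>
        interchange C X Y (X \<otimes> ?I) (Y \<otimes> ?I)) \<cdot> ((Idn C (X \<otimes> Y) \<odot> ?int) \<cdot> \<delta> ?XY (Suc 0)))"
      unfolding D[symmetric] by simp
    also have "\<dots> = (p1 X Y \<odot> (p1 Y ?I \<cdot> (p2 (X \<otimes> ?I) (Y \<otimes> ?I) \<cdot> ?int))) \<cdot> \<delta> ?XY (Suc 0)"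
      by (simp add: p1_p2_interchange)
    also have "\<dots> = c"
      by (simp add: p2_interchange c_def)
    finally show ?thesis by simp
  qed
  \<comment> \<open>By naturality of \<delta>, \<open>c\<close> sees \<open>k\<close> only through
    its two projections.\<close>
  have nat: "c \<cdot> (k \<odot> ?j) = ((p1 X Y \<cdot> k) \<odot> ((p2 X Y \<cdot> k) \<cdot> p1 Z ?I)) \<cdot> \<delta> (pad Z) (Suc 0)"
    if [simp]: "k \<in> Arr C" "Dom C k = Z" "Cod C k = X \<otimes> Y" for k
  proof -
    have "\<delta> ?XY (Suc 0) \<cdot> (k \<odot> ?j) = (k \<odot> (k \<odot> ?j)) \<cdot> \<delta> (pad Z) (Suc 0)"
      using delta_natural[of "case_nat k (\<lambda>_. ?j)" "pad Z" ?XY "Suc 0"]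
      by (simp add: hom_def split: nat.splits)
    then show ?thesis by (simp add: c_def)
  qed
  obtain e where e: "e \<in> hom C Y Y" "e \<cdot> t = p1 Y ?I"
    using left_inverse_p2_delta[of Y] unfolding t_def by auto
  have [simp]: "e \<in> Arr C" "Dom C e = Y" "Cod C e = Y"
    using e(1) by (auto simp: hom_def)
  \<comment> \<open>After these retractions only isomorphisms remain in front of
    \<open>h \<odot> ?j\<close>, and they can be cancelled.\<close>
  have st: "(\<epsilon> (pad X) 0 \<odot> e) \<cdot> (s \<odot> t) = RUnit C X \<odot> RUnit C Y"
    using left_inverse_p1_delta[of X] e(2) by (simp add: s_def RUnit_eq_p1)
  have "c \<cdot> (h \<odot> ?j) = c \<cdot> (h' \<odot> ?j)"
    using nat[of h] nat[of h'] p1 p2 by simp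
  then have "(\<epsilon> (pad X) 0 \<odot> e) \<cdot> ((s \<odot> t) \<cdot> (?int \<cdot> (h \<odot> ?j)))
      = (\<epsilon> (pad X) 0 \<odot> e) \<cdot> ((s \<odot> t) \<cdot> (?int \<cdot> (h' \<odot> ?j)))"
    by (simp add: c)
  then have "((RUnit C X \<odot> RUnit C Y) \<cdot> ?int) \<cdot> (h \<odot> ?j) = ((RUnit C X \<odot> RUnit C Y) \<cdot> ?int) \<cdot> (h' \<odot> ?j)"
    by (simp add: Cmp_reassoc[OF st] del: TensArr_Cmp_TensArr')
  then have "h \<odot> ?j = h' \<odot> ?j"
    by (rule iso_cancel_left[rotated 5]) simp_all
  \<comment> \<open>The projection discards \<open>?j\<close> and returns \<open>h\<close> up to the
    right unitor.\<close>
  then have "p1 (X \<otimes> Y) (?I \<otimes> ?I) \<cdot> (h \<odot> ?j) = p1 (X \<otimes> Y) (?I \<otimes> ?I) \<cdot> (h' \<odot> ?j)"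
    by (simp only:)
  then have "h \<cdot> RUnit C Z = h' \<cdot> RUnit C Z"
    by (simp add: RUnit_eq_p1)
  then show ?thesis
    by (rule iso_cancel_right[rotated 5]) simp_all
qed

lemma comonad_imp_cartesian: "cartesian_monoidal C"
proof -
  have "is_product C X Y (X \<otimes> Y) (p1 X Y) (p2 X Y)" if "X \<in> Obj C" "Y \<in> Obj C" for X Y
    unfolding is_product_def
    using that pairing_exists projections_jointly_monic[of _ _ X Y]
    by (auto simp: hom_def Ex1_def) metis+
  then show ?thesis
    unfolding cartesian_monoidal_def p1_def p2_def using Unit_terminal by blast
qed

end

section \<open>Functors between cartesian monoidal categories\<close>

locale cartesian_category = monoidal_category +
  assumes cartesian: "cartesian_monoidal C"

sublocale cartesian_category \<subseteq> semicartesian_category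
  using cartesian by unfold_locales (simp add: cartesian_monoidal_def)

context cartesian_category
begin

lemma product: "X \<in> Obj C \<Longrightarrow> Y \<in> Obj C \<Longrightarrow> is_product C X Y (X \<otimes> Y) (p1 X Y) (p2 X Y)"
  using cartesian by (simp add: cartesian_monoidal_def p1_def p2_def)

definition pair :: "'b \<Rightarrow> 'b \<Rightarrow> 'b" where
  "pair f g = (THE h. h \<in> hom C (Dom C f) (Cod C f \<otimes> Cod C g) \<and>
     p1 (Cod C f) (Cod C g) \<cdot> h = f \<and> p2 (Cod C f) (Cod C g) \<cdot> h = g)"

lemma
  assumes "f \<in> Arr C" "g \<in> Arr C" "Dom C f = Dom C g"
  shows Arr_pair [simp]: "pair f g \<in> Arr C"
    and Dom_pair [simp]: "Dom C (pair f g) = Dom C g"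
    and Cod_pair [simp]: "Cod C (pair f g) = Cod C f \<otimes> Cod C g"
    and p1_pair: "p1 (Cod C f) (Cod C g) \<cdot> pair f g = f"
    and p2_pair: "p2 (Cod C f) (Cod C g) \<cdot> pair f g = g"
proof -
  have "\<exists>!h. h \<in> hom C (Dom C f) (Cod C f \<otimes> Cod C g) \<and>
     p1 (Cod C f) (Cod C g) \<cdot> h = f \<and> p2 (Cod C f) (Cod C g) \<cdot> h = g"
    using product[of "Cod C f" "Cod C g"] assms by (simp add: is_product_def hom_def)
  from theI'[OF this] show "pair f g \<in> Arr C" "Dom C (pair f g) = Dom C g"
    "Cod C (pair f g) = Cod C f \<otimes> Cod C g"
    "p1 (Cod C f) (Cod C g) \<cdot> pair f g = f" "p2 (Cod C f) (Cod C g) \<cdot> pair f g = g"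
    unfolding pair_def[symmetric] using assms(3) by (auto simp: hom_def)
qed

lemma
  assumes "f \<in> Arr C" "g \<in> Arr C" "Dom C f = Dom C g" "Cod C f = X" "Cod C g = Y"
  shows p1_pair_Cmp [simp]: "p1 X Y \<cdot> pair f g = f"
    and p2_pair_Cmp [simp]: "p2 X Y \<cdot> pair f g = g"
  using p1_pair p2_pair assms by auto

text \<open>This rule reduces the laws of the converse direction to equations between
  projections.\<close>

lemma prod_eqI:
  assumes "h \<in> Arr C" "k \<in> Arr C" "Dom C h = Dom C k" "Cod C h = X \<otimes> Y" "Cod C k = X \<otimes> Y"
    and [simp]: "X \<in> Obj C" "Y \<in> Obj C"
    and "p1 X Y \<cdot> h = p1 X Y \<cdot> k" "p2 X Y \<cdot> h = p2 X Y \<cdot> k"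
  shows "h = k"
proof -
  have [simp]: "p1 X Y \<cdot> h \<in> hom C (Dom C h) X" "p2 X Y \<cdot> h \<in> hom C (Dom C h) Y"
    using assms(1-5) by (simp_all add: hom_def)
  have "\<exists>!l. l \<in> hom C (Dom C h) (X \<otimes> Y) \<and> p1 X Y \<cdot> l = p1 X Y \<cdot> h \<and> p2 X Y \<cdot> l = p2 X Y \<cdot> h"
    using product[of X Y] assms(1) by (simp add: is_product_def)
  moreover have "h \<in> hom C (Dom C h) (X \<otimes> Y)" "k \<in> hom C (Dom C h) (X \<otimes> Y)"
    using assms(1-5) by (simp_all add: hom_def)
  ultimately show ?thesis
    using assms(8,9) by metis
qed

end

text \<open>The two projection equations determine \<open>OpTens\<close>; its naturality and the
  oplax laws are derived from them below. Typing is phrased through \<open>Arr\<close>,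
  \<open>Dom\<close> and \<open>Cod\<close> to serve as rewrite rules.\<close>

locale projection_preserving_functor =
  C: cartesian_category C + D: cartesian_category D
  for C :: "('o, 'a, 'x) moncat_scheme"
    and D :: "('p, 'b, 'y) moncat_scheme" (structure)
    and F :: "('o, 'a, 'p, 'b) oplax" +
  assumes Obj_FObj [simp]: "X \<in> Obj C \<Longrightarrow> FObj F X \<in> Obj D"
    and Arr_FArr [simp]: "f \<in> Arr C \<Longrightarrow> FArr F f \<in> Arr D"
    and Dom_FArr [simp]: "f \<in> Arr C \<Longrightarrow> Dom D (FArr F f) = FObj F (Dom C f)"
    and Cod_FArr [simp]: "f \<in> Arr C \<Longrightarrow> Cod D (FArr F f) = FObj F (Cod C f)"
    and FArr_id [simp]: "X \<in> Obj C \<Longrightarrow> FArr F (Idn C X) = Idn D (FObj F X)"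
    and FArr_comp: "\<lbrakk>f \<in> Arr C; g \<in> Arr C; Dom C g = Cod C f\<rbrakk>
      \<Longrightarrow> FArr F (g \<cdot>\<^bsub>C\<^esub> f) = FArr F g \<cdot> FArr F f"
    and OpUnit_hom: "OpUnit F \<in> hom D (FObj F (Unit C)) (Unit D)"
    and OpTens_hom: "\<lbrakk>X \<in> Obj C; Y \<in> Obj C\<rbrakk>
      \<Longrightarrow> OpTens F X Y \<in> hom D (FObj F (X \<otimes>\<^bsub>C\<^esub> Y)) (FObj F X \<otimes> FObj F Y)"
    and p1_OpTens [simp]: "\<lbrakk>X \<in> Obj C; Y \<in> Obj C\<rbrakk>
      \<Longrightarrow> D.p1 (FObj F X) (FObj F Y) \<cdot> OpTens F X Y = FArr F (C.p1 X Y)"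
    and p2_OpTens [simp]: "\<lbrakk>X \<in> Obj C; Y \<in> Obj C\<rbrakk>
      \<Longrightarrow> D.p2 (FObj F X) (FObj F Y) \<cdot> OpTens F X Y = FArr F (C.p2 X Y)"
begin

lemma
  shows Arr_OpUnit [simp]: "OpUnit F \<in> Arr D"
    and Dom_OpUnit [simp]: "Dom D (OpUnit F) = FObj F (Unit C)"
    and Cod_OpUnit [simp]: "Cod D (OpUnit F) = Unit D"
  using OpUnit_hom by (simp_all add: hom_def)

lemma
  assumes "X \<in> Obj C" "Y \<in> Obj C"
  shows Arr_OpTens [simp]: "OpTens F X Y \<in> Arr D"
    and Dom_OpTens [simp]: "Dom D (OpTens F X Y) = FObj F (X \<otimes>\<^bsub>C\<^esub> Y)"
    and Cod_OpTens [simp]: "Cod D (OpTens F X Y) = FObj F X \<otimes> FObj F Y"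
  using OpTens_hom[OF assms] by (simp_all add: hom_def)

lemma p1_OpTens' [simp]:
  assumes "X \<in> Obj C" "Y \<in> Obj C" "h \<in> Arr D" "Cod D h = FObj F (X \<otimes>\<^bsub>C\<^esub> Y)"
  shows "D.p1 (FObj F X) (FObj F Y) \<cdot> (OpTens F X Y \<cdot> h) = FArr F (C.p1 X Y) \<cdot> h"
  using assms by (intro D.Cmp_reassoc) simp_all

lemma p2_OpTens' [simp]:
  assumes "X \<in> Obj C" "Y \<in> Obj C" "h \<in> Arr D" "Cod D h = FObj F (X \<otimes>\<^bsub>C\<^esub> Y)"
  shows "D.p2 (FObj F X) (FObj F Y) \<cdot> (OpTens F X Y \<cdot> h) = FArr F (C.p2 X Y) \<cdot> h"
  using assms by (intro D.Cmp_reassoc) simp_all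

sublocale oplax_monoidal_functor C D F
proof unfold_locales
  show "FArr F (g \<cdot>\<^bsub>C\<^esub> f) = FArr F g \<cdot> FArr F f" if "f \<in> hom C X Y" "g \<in> hom C Y Z" for f g X Y Z
    using that by (auto simp: hom_def intro: FArr_comp)
  show "OpTens F X' Y' \<cdot> FArr F (f \<odot>\<^bsub>C\<^esub> g) = (FArr F f \<odot> FArr F g) \<cdot> OpTens F X Y"
    if "f \<in> hom C X X'" "g \<in> hom C Y Y'" for f g X X' Y Y'
  proof -
    have [simp]: "f \<in> Arr C" "Dom C f = X" "Cod C f = X'" "g \<in> Arr C" "Dom C g = Y" "Cod C g = Y'"
      using that by (auto simp: hom_def)
    have [simp]: "X \<in> Obj C" "Y \<in> Obj C" "X' \<in> Obj C" "Y' \<in> Obj C"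
      using C.Dom_Obj[of f] C.Dom_Obj[of g] C.Cod_Obj[of f] C.Cod_Obj[of g] by simp_all
    show ?thesis
      by (rule D.prod_eqI[of _ _ "FObj F X'" "FObj F Y'"]) (simp_all flip: FArr_comp)
  qed
  show "Assoc D (FObj F X) (FObj F Y) (FObj F Z)
            \<cdot> (OpTens F X Y \<odot> Idn D (FObj F Z)) \<cdot> OpTens F (X \<otimes>\<^bsub>C\<^esub> Y) Z
        = (Idn D (FObj F X) \<odot> OpTens F Y Z) \<cdot> OpTens F X (Y \<otimes>\<^bsub>C\<^esub> Z) \<cdot> FArr F (Assoc C X Y Z)"
    if [simp]: "X \<in> Obj C" "Y \<in> Obj C" "Z \<in> Obj C" for X Y Z
  proof (rule D.prod_eqI)
    let ?l = "Assoc D (FObj F X) (FObj F Y) (FObj F Z)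
            \<cdot> (OpTens F X Y \<odot> Idn D (FObj F Z)) \<cdot> OpTens F (X \<otimes>\<^bsub>C\<^esub> Y) Z"
    let ?r = "(Idn D (FObj F X) \<odot> OpTens F Y Z) \<cdot> OpTens F X (Y \<otimes>\<^bsub>C\<^esub> Z) \<cdot> FArr F (Assoc C X Y Z)"
    show "D.p1 (FObj F X) (FObj F Y \<otimes> FObj F Z) \<cdot> ?l = D.p1 (FObj F X) (FObj F Y \<otimes> FObj F Z) \<cdot> ?r"
      by (simp add: D.Cmp_reassoc[OF D.p1_Assoc] flip: FArr_comp)
    show "D.p2 (FObj F X) (FObj F Y \<otimes> FObj F Z) \<cdot> ?l = D.p2 (FObj F X) (FObj F Y \<otimes> FObj F Z) \<cdot> ?r"
      \<comment> \<open>The second component is again an arrow into a tensor, so the comparison is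
        repeated one level down.\<close>
      by (rule D.prod_eqI[of _ _ "FObj F Y" "FObj F Z"])
        (simp_all add: D.Cmp_reassoc[OF D.p2_Assoc] flip: FArr_comp)
  qed simp_all
  show "LUnit D (FObj F X) \<cdot> (OpUnit F \<odot> Idn D (FObj F X)) \<cdot> OpTens F (Unit C) X = FArr F (LUnit C X)"
    if "X \<in> Obj C" for X
    \<comment> \<open>With both left unitors read as \<open>p2\<close>, this is the projection
      equation for \<open>OpTens\<close>; \<open>OpUnit\<close> disappears with the first
      factor.\<close>
    using that by (simp add: C.LUnit_eq_p2 D.LUnit_eq_p2)
  show "RUnit D (FObj F X) \<cdot> (Idn D (FObj F X) \<odot> OpUnit F) \<cdot> OpTens F X (Unit C) = FArr F (RUnit C X)"
    if "X \<in> Obj C" for X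
    using that by (simp add: C.RUnit_eq_p1 D.RUnit_eq_p1)
qed (auto simp: hom_def)

end

lemma projection_preserving_id:
  assumes "cartesian_category C"
  shows "projection_preserving_functor C C (id_oplax C)"
proof -
  interpret cartesian_category C by (rule assms)
  show ?thesis
    by unfold_locales (simp_all add: hom_def)
qed

lemma projection_preserving_comp:
  assumes "projection_preserving_functor C D F" "projection_preserving_functor D E G"
  shows "projection_preserving_functor C E (comp_oplax E G F)"
proof -
  interpret F: projection_preserving_functor C D F by (rule assms)
  interpret G: projection_preserving_functor D E G by (rule assms)
  show ?thesis
    \<comment> \<open>The flipped instance merges the images under \<open>G\<close> of a projection
      and of \<open>OpTens F\<close>, so that the projection equation for \<open>F\<close> applies
      inside \<open>G\<close>.\<close>
    by unfold_locales (simp_all add: hom_def F.FArr_comp G.FArr_comp flip: G.FArr_comp[of "OpTens F _ _"])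
qed

text \<open>The unit law holds by terminality; projected to either factor, the tensor law is
  naturality of \<theta> at a projection.\<close>

lemma nat_trans_monoidal:
  assumes "projection_preserving_functor C D F" "projection_preserving_functor C D G"
    and hom: "\<And>X. X \<in> Obj C \<Longrightarrow> \<theta> X \<in> hom D (FObj F X) (FObj G X)"
    and nat: "\<And>f X Y. f \<in> hom C X Y \<Longrightarrow> \<theta> Y \<cdot>\<^bsub>D\<^esub> FArr F f = FArr G f \<cdot>\<^bsub>D\<^esub> \<theta> X"
  shows "monoidal_nat_trans C D F G \<theta>"
proof -
  interpret F: projection_preserving_functor C D F by (rule assms)
  interpret G: projection_preserving_functor C D G by (rule assms)
  have [simp]: "\<theta> X \<in> Arr D" "Dom D (\<theta> X) = FObj F X" "Cod D (\<theta> X) = FObj G X" if "X \<in> Obj C" for X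
    using hom[OF that] by (simp_all add: hom_def)
  show ?thesis
  proof unfold_locales
    show "OpUnit G \<cdot>\<^bsub>D\<^esub> \<theta> (Unit C) = OpUnit F"
      by (rule F.D.to_Unit_unique) simp_all
    show "OpTens G X Y \<cdot>\<^bsub>D\<^esub> \<theta> (X \<otimes>\<^bsub>C\<^esub> Y) = (\<theta> X \<odot>\<^bsub>D\<^esub> \<theta> Y) \<cdot>\<^bsub>D\<^esub> OpTens F X Y"
      if [simp]: "X \<in> Obj C" "Y \<in> Obj C" for X Y
      by (rule F.D.prod_eqI[of _ _ "FObj G X" "FObj G Y"])
        (simp_all add: nat[of _ "X \<otimes>\<^bsub>C\<^esub> Y"] hom_def)
  qed (use hom nat in simp_all)
qed

section \<open>The comonad of nonempty lists\<close>

lemma (in monoidal_category) iso_arr_seq_cat: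
  assumes "\<And>n. iso_arr C (f n)"
  shows "iso_arr (seq_cat C) f"
  unfolding iso_arr_def inverse_arrows_def
  by (rule exI[of _ "\<lambda>n. inv_arr C (f n)"]) (use assms Arr_iso in \<open>simp add: hom_seq_iff\<close>)

lemma (in monoidal_category) monoidal_seq_cat: "monoidal_category (seq_cat C)"
proof unfold_locales
  fix f g h X X' Y Y' Z Z'
  assume "f \<in> hom (seq_cat C) X X'" "g \<in> hom (seq_cat C) Y Y'" "h \<in> hom (seq_cat C) Z Z'"
  then show "Assoc (seq_cat C) X' Y' Z' \<cdot>\<^bsub>seq_cat C\<^esub> ((f \<odot>\<^bsub>seq_cat C\<^esub> g) \<odot>\<^bsub>seq_cat C\<^esub> h)
      = (f \<odot>\<^bsub>seq_cat C\<^esub> (g \<odot>\<^bsub>seq_cat C\<^esub> h)) \<cdot>\<^bsub>seq_cat C\<^esub> Assoc (seq_cat C) X Y Z"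
    by (simp add: hom_seq_iff Assoc_nat)
next
  fix f X Y
  assume "f \<in> hom (seq_cat C) X Y"
  then have f: "f n \<in> hom C (X n) (Y n)" for n
    by (simp add: hom_seq_cat)
  show "LUnit (seq_cat C) Y \<cdot>\<^bsub>seq_cat C\<^esub> (Idn (seq_cat C) (Unit (seq_cat C)) \<odot>\<^bsub>seq_cat C\<^esub> f)
      = f \<cdot>\<^bsub>seq_cat C\<^esub> LUnit (seq_cat C) X"
    using LUnit_natural[OF f] by simp
  show "RUnit (seq_cat C) Y \<cdot>\<^bsub>seq_cat C\<^esub> (f \<odot>\<^bsub>seq_cat C\<^esub> Idn (seq_cat C) (Unit (seq_cat C)))
      = f \<cdot>\<^bsub>seq_cat C\<^esub> RUnit (seq_cat C) X"
    using RUnit_natural[OF f] by simp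
qed (simp_all add: hom_seq_iff iso_arr_seq_cat pentagon triangle)

section \<open>Finite products of sequences, formed degreewise\<close>

context cartesian_category
begin

lemma seq_hom_Unit:
  assumes "\<And>n. X n \<in> Obj C"
  shows "f \<in> hom (seq_cat C) X (Unit (seq_cat C)) \<longleftrightarrow> f = (\<lambda>n. ! (X n))"
  using assms by (auto simp: hom_seq_iff intro!: ext to_Unit_unique)

lemma seq_discard [simp]:
  "(\<And>n. X n \<in> Obj C) \<Longrightarrow> to_terminal (seq_cat C) (\<lambda>n. Unit C) X = (\<lambda>n. ! (X n))"
  using seq_hom_Unit[of X] by (simp add: to_terminal_def)

lemma seq_product:
  assumes [simp]: "\<And>n. X n \<in> Obj C" "\<And>n. Y n \<in> Obj C"
  shows "is_product (seq_cat C) X Y (\<lambda>n. X n \<otimes> Y n) (\<lambda>n. p1 (X n) (Y n)) (\<lambda>n. p2 (X n) (Y n))"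
proof -
  have "\<exists>!h. h \<in> hom (seq_cat C) Z (\<lambda>n. X n \<otimes> Y n) \<and>
      (\<lambda>n. p1 (X n) (Y n) \<cdot> h n) = f \<and> (\<lambda>n. p2 (X n) (Y n) \<cdot> h n) = g"
    if "f \<in> hom (seq_cat C) Z X" "g \<in> hom (seq_cat C) Z Y" for Z f g
  proof
    have [simp]: "f n \<in> Arr C" "Dom C (f n) = Z n" "Cod C (f n) = X n"
      "g n \<in> Arr C" "Dom C (g n) = Z n" "Cod C (g n) = Y n" for n
      using that by (simp_all add: hom_seq_iff)
    show "(\<lambda>n. pair (f n) (g n)) \<in> hom (seq_cat C) Z (\<lambda>n. X n \<otimes> Y n) \<and>
      (\<lambda>n. p1 (X n) (Y n) \<cdot> pair (f n) (g n)) = f \<and> (\<lambda>n. p2 (X n) (Y n) \<cdot> pair (f n) (g n)) = g"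
      by (simp add: hom_seq_iff)
    fix h
    assume h: "h \<in> hom (seq_cat C) Z (\<lambda>n. X n \<otimes> Y n) \<and>
      (\<lambda>n. p1 (X n) (Y n) \<cdot> h n) = f \<and> (\<lambda>n. p2 (X n) (Y n) \<cdot> h n) = g"
    show "h = (\<lambda>n. pair (f n) (g n))"
    proof
      fix n
      have "p1 (X n) (Y n) \<cdot> h n = f n" "p2 (X n) (Y n) \<cdot> h n = g n"
        using h by auto
      moreover have "h n \<in> Arr C" "Dom C (h n) = Z n" "Cod C (h n) = X n \<otimes> Y n"
        using h by (simp_all add: hom_seq_iff)
      ultimately show "h n = pair (f n) (g n)"
        by (simp add: prod_eqI[of _ _ "X n" "Y n"])
    qed
  qed
  then show ?thesis
    by (simp add: is_product_def hom_seq_iff)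
qed

lemma cartesian_seq_cat: "cartesian_category (seq_cat C)"
proof -
  interpret S: monoidal_category "seq_cat C" by (rule monoidal_seq_cat)
  show ?thesis
  proof unfold_locales
    show "cartesian_monoidal (seq_cat C)"
      unfolding cartesian_monoidal_def terminal_def
      using seq_hom_Unit seq_product by (simp add: p1_def p2_def)
  qed
qed

end

section \<open>The list functor preserves projections\<close>

locale cartesian_symmetric_category = symmetric_monoidal_category + cartesian_category
begin

sublocale semicartesian_symmetric_category ..

sublocale S: cartesian_category "seq_cat C"
  by (rule cartesian_seq_cat)

lemma seq_p1 [simp]:
  "(\<And>n. X n \<in> Obj C) \<Longrightarrow> (\<And>n. Y n \<in> Obj C) \<Longrightarrow> S.p1 X Y = (\<lambda>n. p1 (X n) (Y n))"
  and seq_p2 [simp]: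
  "(\<And>n. X n \<in> Obj C) \<Longrightarrow> (\<And>n. Y n \<in> Obj C) \<Longrightarrow> S.p2 X Y = (\<lambda>n. p2 (X n) (Y n))"
  by (simp_all add: S.p1_def S.p2_def p1_def p2_def)

text \<open>The target A \<otimes> A' is itself a product, so the components in \<open>A\<close> and
  in \<open>A'\<close> are compared separately.\<close>

lemma p1_interchange:
  assumes [simp]: "A \<in> Obj C" "B \<in> Obj C" "A' \<in> Obj C" "B' \<in> Obj C"
  shows "p1 (A \<otimes> A') (B \<otimes> B') \<cdot> interchange C A B A' B' = p1 A B \<odot> p1 A' B'"
proof (rule prod_eqI[of _ _ A A'])
  let ?i = "inv_arr C (Assoc C A A' (B \<otimes> B'))"
  let ?k = "(Idn C A \<odot> (Assoc C A' B B' \<cdot> ((Symm C B A' \<odot> Idn C B') \<cdot> inv_arr C (Assoc C B A' B'))))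
    \<cdot> Assoc C A B (A' \<otimes> B')"
  have int: "interchange C A B A' B' = ?i \<cdot> ?k"
    by (simp add: interchange_def)
  have "p1 A A' \<cdot> (p1 (A \<otimes> A') (B \<otimes> B') \<cdot> (?i \<cdot> ?k))
      = (p1 A A' \<cdot> (p1 (A \<otimes> A') (B \<otimes> B') \<cdot> ?i)) \<cdot> ?k"
    by (simp del: p1_p1_inv_Assoc)
  also have "\<dots> = p1 A A' \<cdot> (p1 A B \<odot> p1 A' B')"
    by simp
  finally show "p1 A A' \<cdot> (p1 (A \<otimes> A') (B \<otimes> B') \<cdot> interchange C A B A' B')
      = p1 A A' \<cdot> (p1 A B \<odot> p1 A' B')"
    by (simp only: int)
  have "p2 A A' \<cdot> (p1 (A \<otimes> A') (B \<otimes> B') \<cdot> (?i \<cdot> ?k))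
      = (p2 A A' \<cdot> (p1 (A \<otimes> A') (B \<otimes> B') \<cdot> ?i)) \<cdot> ?k"
    by (simp del: p2_p1_inv_Assoc)
  also have "\<dots> = p1 A' (B \<otimes> B') \<cdot> (Assoc C A' B B' \<cdot> ((Symm C B A' \<odot> Idn C B')
      \<cdot> (inv_arr C (Assoc C B A' B') \<cdot> (p2 A B \<odot> Idn C (A' \<otimes> B')))))"
    by (simp del: p1_Assoc)
  also have "\<dots> = (p2 B A' \<cdot> (p1 (B \<otimes> A') B' \<cdot> inv_arr C (Assoc C B A' B')))
      \<cdot> (p2 A B \<odot> Idn C (A' \<otimes> B'))"
    by (simp add: Cmp_reassoc[OF p1_Assoc] Cmp_reassoc[OF p1_Symm] del: p2_p1_inv_Assoc)
  also have "\<dots> = p2 A A' \<cdot> (p1 A B \<odot> p1 A' B')"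
    by simp
  finally show "p2 A A' \<cdot> (p1 (A \<otimes> A') (B \<otimes> B') \<cdot> interchange C A B A' B')
      = p2 A A' \<cdot> (p1 A B \<odot> p1 A' B')"
    by (simp only: int)
qed simp_all

lemma Obj_list_obj [simp]: "(\<And>n. X n \<in> Obj C) \<Longrightarrow> list_obj C X n \<in> Obj C"
  by (induction n) simp_all

lemma
  assumes "\<And>n. f n \<in> Arr C"
  shows Arr_list_arr [simp]: "list_arr C f n \<in> Arr C"
    and Dom_list_arr [simp]: "Dom C (list_arr C f n) = list_obj C (\<lambda>n. Dom C (f n)) n"
    and Cod_list_arr [simp]: "Cod C (list_arr C f n) = list_obj C (\<lambda>n. Cod C (f n)) n"
  by (induction n) (simp_all add: assms)

lemma list_arr_Idn [simp]:
  "(\<And>n. X n \<in> Obj C) \<Longrightarrow> list_arr C (\<lambda>n. Idn C (X n)) n = Idn C (list_obj C X n)"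
  by (induction n) simp_all

lemma list_arr_Cmp:
  assumes "\<And>n. f n \<in> Arr C" "\<And>n. g n \<in> Arr C" "\<And>n. Dom C (g n) = Cod C (f n)"
  shows "list_arr C (\<lambda>n. g n \<cdot> f n) n = list_arr C g n \<cdot> list_arr C f n"
  by (induction n) (simp_all add: assms)

lemma list_op_unit_in_hom: "list_op_unit C n \<in> hom C (list_obj C (\<lambda>n. Unit C) n) (Unit C)"
  by (induction n) (simp_all add: hom_def)

lemma
  assumes [simp]: "\<And>n. X n \<in> Obj C" "\<And>n. Y n \<in> Obj C"
  shows Arr_list_op_tens [simp]: "list_op_tens C X Y n \<in> Arr C"
    and Dom_list_op_tens [simp]: "Dom C (list_op_tens C X Y n) = list_obj C (\<lambda>n. X n \<otimes> Y n) n"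
    and Cod_list_op_tens [simp]: "Cod C (list_op_tens C X Y n) = list_obj C X n \<otimes> list_obj C Y n"
  by (induction n) simp_all

text \<open>In the induction step \<open>p1_interchange\<close> splits the projection into one for
  the initial segment and one for the last entry.\<close>

lemma p1_list_op_tens:
  assumes [simp]: "\<And>n. X n \<in> Obj C" "\<And>n. Y n \<in> Obj C"
  shows "p1 (list_obj C X n) (list_obj C Y n) \<cdot> list_op_tens C X Y n
    = list_arr C (\<lambda>n. p1 (X n) (Y n)) n"
  by (induction n) (simp_all add: Cmp_reassoc[OF p1_interchange])

lemma p2_list_op_tens:
  assumes [simp]: "\<And>n. X n \<in> Obj C" "\<And>n. Y n \<in> Obj C"
  shows "p2 (list_obj C X n) (list_obj C Y n) \<cdot> list_op_tens C X Y n
    = list_arr C (\<lambda>n. p2 (X n) (Y n)) n"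
  by (induction n) (simp_all add: Cmp_reassoc[OF p2_interchange])

lemma projection_preserving_ListPlus:
  "projection_preserving_functor (seq_cat C) (seq_cat C) (ListPlus C)"
  by unfold_locales
    (simp_all add: hom_seq_cat list_op_unit_in_hom fun_eq_iff list_arr_Cmp
      p1_list_op_tens p2_list_op_tens, simp_all add: hom_def)

section \<open>Last entries, prefixes and the comonad laws\<close>

primrec last_proj :: "(nat \<Rightarrow> 'a) \<Rightarrow> nat \<Rightarrow> 'b" where
  "last_proj X 0 = Idn C (X 0)"
| "last_proj X (Suc n) = p2 (list_obj C X n) (X (Suc n))"

text \<open>The longest prefix is the whole list, whence the identity; the shorter ones are the
  prefixes of the list whose last entry \<open>p1\<close> has dropped.\<close>

primrec prefixes :: "(nat \<Rightarrow> 'a) \<Rightarrow> nat \<Rightarrow> 'b" where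
  "prefixes X 0 = Idn C (X 0)"
| "prefixes X (Suc n)
    = pair (prefixes X n \<cdot> p1 (list_obj C X n) (X (Suc n))) (Idn C (list_obj C X (Suc n)))"

lemma
  assumes [simp]: "\<And>n. X n \<in> Obj C"
  shows Arr_last_proj [simp]: "last_proj X n \<in> Arr C"
    and Dom_last_proj [simp]: "Dom C (last_proj X n) = list_obj C X n"
    and Cod_last_proj [simp]: "Cod C (last_proj X n) = X n"
  by (cases n; simp)+

lemma
  assumes [simp]: "\<And>n. X n \<in> Obj C"
  shows Arr_prefixes [simp]: "prefixes X n \<in> Arr C"
    and Dom_prefixes [simp]: "Dom C (prefixes X n) = list_obj C X n"
    and Cod_prefixes [simp]: "Cod C (prefixes X n) = list_obj C (list_obj C X) n"
  by (induction n) simp_all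

lemma last_proj_natural:
  assumes [simp]: "\<And>n. f n \<in> Arr C"
  shows "last_proj (\<lambda>n. Cod C (f n)) n \<cdot> list_arr C f n = f n \<cdot> last_proj (\<lambda>n. Dom C (f n)) n"
  by (cases n) simp_all

text \<open>On the last factor both sides are \<open>list_arr C f (Suc n)\<close>; on the others the
  induction hypothesis applies after dropping the last entry.\<close>

lemma prefixes_natural:
  assumes [simp]: "\<And>n. f n \<in> Arr C"
  shows "prefixes (\<lambda>n. Cod C (f n)) n \<cdot> list_arr C f n
    = list_arr C (list_arr C f) n \<cdot> prefixes (\<lambda>n. Dom C (f n)) n"
proof (induction n)
  case (Suc n)
  let ?X = "\<lambda>n. Dom C (f n)" and ?Y = "\<lambda>n. Cod C (f n)"
  show ?case
    by (rule prod_eqI[of _ _ "list_obj C (list_obj C ?Y) n" "list_obj C ?Y (Suc n)"])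
      (simp_all add: Cmp_reassoc[OF p1_pair_Cmp] Cmp_reassoc[OF p2_pair_Cmp] Cmp_reassoc[OF Suc.IH])
qed simp

lemma last_proj_prefixes:
  assumes [simp]: "\<And>n. X n \<in> Obj C"
  shows "last_proj (list_obj C X) n \<cdot> prefixes X n = Idn C (list_obj C X n)"
  by (cases n) simp_all

text \<open>The longest prefix contributes the last entry of the list; the shorter prefixes give the
  remaining entries by induction.\<close>

lemma list_arr_last_proj_prefixes:
  assumes [simp]: "\<And>n. X n \<in> Obj C"
  shows "list_arr C (last_proj X) n \<cdot> prefixes X n = Idn C (list_obj C X n)"
proof (induction n)
  case (Suc n)
  show ?case
    by (rule prod_eqI[of _ _ "list_obj C X n" "X (Suc n)"])
      (simp_all add: Cmp_reassoc[OF Suc.IH])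
qed simp

text \<open>On the last factor both sides are \<open>prefixes X (Suc n)\<close>; the other factors
  are the induction hypothesis preceded by \<open>p1\<close>.\<close>

lemma prefixes_coassoc:
  assumes [simp]: "\<And>n. X n \<in> Obj C"
  shows "prefixes (list_obj C X) n \<cdot> prefixes X n = list_arr C (prefixes X) n \<cdot> prefixes X n"
proof (induction n)
  case (Suc n)
  let ?L = "list_obj C X"
  show ?case
    by (rule prod_eqI[of _ _ "list_obj C (list_obj C ?L) n" "list_obj C ?L (Suc n)"])
      (simp_all add: Cmp_reassoc[OF p1_pair_Cmp] Cmp_reassoc[OF p2_pair_Cmp] Cmp_reassoc[OF Suc.IH])
qed simp

lemma last_proj_prefixes_comonad:
  "oplax_monoidal_comonad (seq_cat C) (ListPlus C) last_proj prefixes"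
proof -
  note L = projection_preserving_ListPlus
  note id = projection_preserving_id[OF cartesian_seq_cat]
  note LL = projection_preserving_comp[OF L L]
  interpret L: projection_preserving_functor "seq_cat C" "seq_cat C" "ListPlus C" by (rule L)
  interpret counit: monoidal_nat_trans "seq_cat C" "seq_cat C" "ListPlus C" "id_oplax (seq_cat C)" last_proj
  \<comment> \<open>This settles the monoidal conditions, leaving naturality and typing.\<close>
  proof (rule nat_trans_monoidal[OF L id])
    fix f X Y
    assume "f \<in> hom (seq_cat C) X Y"
    then show "last_proj Y \<cdot>\<^bsub>seq_cat C\<^esub> FArr (ListPlus C) f
        = FArr (id_oplax (seq_cat C)) f \<cdot>\<^bsub>seq_cat C\<^esub> last_proj X"
      using last_proj_natural[of f] by (auto simp: hom_def)
  qed (simp add: hom_seq_iff)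
  interpret comult: monoidal_nat_trans "seq_cat C" "seq_cat C" "ListPlus C"
    "comp_oplax (seq_cat C) (ListPlus C) (ListPlus C)" prefixes
  proof (rule nat_trans_monoidal[OF L LL])
    fix f X Y
    assume "f \<in> hom (seq_cat C) X Y"
    then show "prefixes Y \<cdot>\<^bsub>seq_cat C\<^esub> FArr (ListPlus C) f
        = FArr (comp_oplax (seq_cat C) (ListPlus C) (ListPlus C)) f \<cdot>\<^bsub>seq_cat C\<^esub> prefixes X"
      using prefixes_natural[of f] by (auto simp: hom_def)
  qed (simp add: hom_seq_iff)
  show ?thesis
    by unfold_locales
      (simp_all add: last_proj_prefixes list_arr_last_proj_prefixes prefixes_coassoc)
qed

end

theorem theorem8p6:
  fixes C :: "('o, 'a) symmoncat"
  assumes "symmetric_monoidal_category C"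
  shows "(\<exists>\<epsilon> \<delta>. oplax_monoidal_comonad (seq_cat C) (ListPlus C) \<epsilon> \<delta>)
    \<longleftrightarrow> cartesian_monoidal C"
proof
  interpret symmetric_monoidal_category C by (rule assms)
  assume "\<exists>\<epsilon> \<delta>. oplax_monoidal_comonad (seq_cat C) (ListPlus C) \<epsilon> \<delta>"
  then obtain \<epsilon> \<delta> where "oplax_monoidal_comonad (seq_cat C) (ListPlus C) \<epsilon> \<delta>" by blast
  then interpret ListPlus_comonad C \<epsilon> \<delta>
    by (intro ListPlus_comonad.intro assms ListPlus_comonad_axioms.intro)
  show "cartesian_monoidal C" by (rule comonad_imp_cartesian)
next
  interpret symmetric_monoidal_category C by (rule assms)
  assume "cartesian_monoidal C"
  then interpret cartesian_symmetric_category C by unfold_locales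
  show "\<exists>\<epsilon> \<delta>. oplax_monoidal_comonad (seq_cat C) (ListPlus C) \<epsilon> \<delta>"
    using last_proj_prefixes_comonad by blast
qed

end
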